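(* Let $k\geqslant 2$ be a fixed integer and let $G\in\mathcal{G}(n,p)$, where the expected degree $d=d(n)=np$ satisfies $d\geqslant c$ and $d^{k-1}=o(n)$ for some large enough constant $c$. Then for any maximal $k$-matching $M_k$ in $G$, with high probability, $$(1+o(1))\frac{(k-1)n\log d}{4d^{k-1}}\leqslant e(M_k)\leqslant (1+o(1))\frac{kn\log d}{2d^{k-1}}.$$
   Context: $\mathcal{G}(n,p)$ is the Erdős–Rényi random graph on vertex set $[n]=\{1,\dots,n\}$ in which each of the $\binom n2$ possible edges is present independently with probability $p$. The distance $d_G(u,v)$ between two vertices is the number of edges of a shortest path between them in $G$ (infinite if none). For a fixed positive integer $k$, a (distance) $k$-matching of $G$ is a set $M$ of edges of $G$ such that no two edges of $M$ are within distance $k$; concretely, for any two distinct edges $e,f\in M$ and any endpoint $u$ of $e$ and endpoint $v$ of $f$, $u\neq v$ and there is no path in $G$ of length at most $k-1$ between $u$ and $v$, i.e. $d_G(u,v)\geqslant k$ (so a $1$-matching is a matching and a $2$-matching is an induced matching). A $k$-matching $M$ is maximal if no other edge of $G$ can be added to $M$ while keeping it a $k$-matching. $e(M)$ denotes the number of edges of $M$. "With high probability" means with probability tending to $1$ as $n\to\infty$; $o(1)$ denotes a quantity tending to $0$ as $n\to\infty$ (or as $c\to\infty$); logarithms are natural. *)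

theory Defs
  imports "HOL-Probability.Probability" "HOL-Library.Landau_Symbols" "HOL-Library.Ramsey"
    "HOL-Library.Extended_Nat"
begin

text \<open>
  A graph on the vertex set \<open>{1..n}\<close> is represented by its edge set, a subset of
  \<open>[{1..n}]\<^bsup>2\<^esup>\<close> (the two-element subsets of \<open>{1..n}\<close>).
\<close>

definition random_graph :: "nat \<Rightarrow> real \<Rightarrow> nat set set pmf" where
  "random_graph n p =
     map_pmf (\<lambda>x. {e \<in> [{1..n}]\<^bsup>2\<^esup>. x e})
       (Pi_pmf ([{1..n}]\<^bsup>2\<^esup>) False (\<lambda>_. bernoulli_pmf p))"

definition path_between :: "'a set set \<Rightarrow> 'a \<Rightarrow> 'a \<Rightarrow> 'a list \<Rightarrow> bool" where
  "path_between E u v xs \<longleftrightarrow>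
     xs \<noteq> [] \<and> hd xs = u \<and> last xs = v \<and> distinct xs \<and> successively (\<lambda>x y. {x, y} \<in> E) xs"

text \<open>
  The list of vertices of a path is one longer than its number of edges. If there is no path,
  the infimum is taken over the empty set, and so is \<open>\<infinity>\<close>.
\<close>

definition graph_dist :: "'a set set \<Rightarrow> 'a \<Rightarrow> 'a \<Rightarrow> enat" where
  "graph_dist E u v = (INF xs\<in>{xs. path_between E u v xs}. enat (length xs - 1))"

definition k_matching :: "nat \<Rightarrow> 'a set set \<Rightarrow> 'a set set \<Rightarrow> bool" where
  "k_matching k E M \<longleftrightarrow>
     M \<subseteq> E \<and>
     (\<forall>e\<in>M. \<forall>f\<in>M. e \<noteq> f \<longrightarrow> (\<forall>u\<in>e. \<forall>v\<in>f. u \<noteq> v \<and> graph_dist E u v \<ge> enat k))"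

definition maximal_k_matching :: "nat \<Rightarrow> 'a set set \<Rightarrow> 'a set set \<Rightarrow> bool" where
  "maximal_k_matching k E M \<longleftrightarrow>
     k_matching k E M \<and> (\<forall>e\<in>E - M. \<not> k_matching k E (insert e M))"

end

theory Submission
  imports Defs "HOL-Real_Asymp.Real_Asymp"
begin

text \<open>
  Write \<open>N = n / d\<^bsup>k-1\<^esup>\<close>; both bounds are first-moment arguments with failure probability
  exponentially small in \<open>N\<close>, valid once \<open>d\<close> and \<open>N\<close> exceed a constant.

  Upper bound: given \<open>m\<close> disjoint pairs, explore the graph from the first one up to depth \<open>k - 2\<close>,
  keeping a prescribed number of roughly \<open>2 d\<^bsup>i\<^esup>\<close> new vertices at depth \<open>i\<close>. The last level
  must send no edge to the \<open>2 j\<close> vertices of the remaining pairs, which costs about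
  \<open>exp (- 4 j / N)\<close>. The used vertices are discarded and the argument is iterated with the next pair.
  If a level turns out too small, which has probability \<open>exp (- \<Omega>(d))\<close>, only this one factor is lost.
  The product, about \<open>exp (- 2 m\<^sup>2 / N)\<close>, beats the number of choices of the pairs as soon as
  \<open>m > (1 + \<epsilon>) k N ln d / 2\<close>.

  Lower bound: let \<open>S\<close> contain the vertices of a maximal \<open>k\<close>-matching. No edge has both ends at
  distance at least \<open>k\<close> from \<open>S\<close>. If \<open>S\<close> is small, then exploring from \<open>S\<close> leaves about
  \<open>n d\<^bsup>-(k-1)/2\<^esup>\<close> such vertices, and the edges among them are unexposed, so that they span an edge
  with a probability that survives the union bound over all \<open>S\<close>.
\<close>

subsection \<open>Random subsets\<close>

text \<open>With \<open>A\<close> the set of pairs of \<open>{1..n}\<close> this is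
  \<open>random_graph n p\<close>. An arbitrary ground set is allowed so that marginals and the set
  of reached vertices belong to the same family.\<close>

definition random_subset :: "'a set \<Rightarrow> real \<Rightarrow> 'a set pmf" where
  "random_subset A p = map_pmf (\<lambda>x. {e \<in> A. x e}) (Pi_pmf A False (\<lambda>_. bernoulli_pmf p))"

lemma set_pmf_random_subset: "set_pmf (random_subset A p) \<subseteq> Pow A"
  by (auto simp: random_subset_def)

lemma random_subset_empty [simp]: "random_subset {} p = return_pmf {}"
  by (simp add: random_subset_def)

lemma random_subset_union:
  assumes "finite A" "finite B" "A \<inter> B = {}"
  shows "random_subset (A \<union> B) p = map_pmf (\<lambda>(X, Y). X \<union> Y) (pair_pmf (random_subset A p) (random_subset B p))"
proof -
  have *: "{e. (e \<in> A \<longrightarrow> f e) \<and> (e \<notin> A \<longrightarrow> e \<in> B \<and> g e)} = {e \<in> A. f e} \<union> {e \<in> B. g e}" for f g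
    using assms(3) by auto
  show ?thesis
    unfolding random_subset_def Pi_pmf_union[OF assms]
    by (simp add: pair_map_pmf1 pair_map_pmf2 map_pmf_comp case_prod_unfold apfst_def apsnd_def
        map_prod_def *)
qed

lemma prob_pair_times:
  "measure_pmf.prob (pair_pmf M N) (A \<times> B) = measure_pmf.prob M A * measure_pmf.prob N B"
proof -
  have "emeasure (pair_pmf M N) (A \<times> B) = (\<integral>\<^sup>+x. indicator (A \<times> B) x \<partial>pair_pmf M N)"
    by simp
  also have "\<dots> = (\<integral>\<^sup>+a. \<integral>\<^sup>+b. indicator A a * indicator B b \<partial>N \<partial>M)"
    unfolding nn_integral_pair_pmf' by (simp add: indicator_times)
  also have "\<dots> = emeasure M A * emeasure N B"
    by (simp add: nn_integral_cmult nn_integral_multc)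
  finally show ?thesis
    by (simp add: measure_pmf.emeasure_eq_measure ennreal_mult[symmetric])
qed

lemma prob_mono_on_support:
  assumes "\<And>x. x \<in> set_pmf M \<Longrightarrow> x \<in> A \<Longrightarrow> x \<in> B"
  shows "measure_pmf.prob M A \<le> measure_pmf.prob M B"
proof -
  have "measure_pmf.prob M A = measure_pmf.prob M (A \<inter> set_pmf M)"
    by (simp add: measure_Int_set_pmf)
  also have "\<dots> \<le> measure_pmf.prob M B"
    using assms by (intro measure_pmf.finite_measure_mono) auto
  finally show ?thesis .
qed

lemma prob_cong_on_support:
  assumes "\<And>x. x \<in> set_pmf M \<Longrightarrow> x \<in> A \<longleftrightarrow> x \<in> B"
  shows "measure_pmf.prob M A = measure_pmf.prob M B"
  using assms by (intro antisym prob_mono_on_support) auto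

lemma random_subset_marginal:
  assumes "finite K" "A \<subseteq> K"
  shows "map_pmf (\<lambda>E. E \<inter> A) (random_subset K p) = random_subset A p"
proof -
  have "random_subset K p = map_pmf (\<lambda>(X, Y). X \<union> Y) (pair_pmf (random_subset A p) (random_subset (K - A) p))"
    using random_subset_union[of A "K - A" p] assms by (simp add: finite_subset Un_absorb1)
  then have "map_pmf (\<lambda>E. E \<inter> A) (random_subset K p) =
      map_pmf (\<lambda>(X, Y). (X \<union> Y) \<inter> A) (pair_pmf (random_subset A p) (random_subset (K - A) p))"
    by (simp add: map_pmf_comp case_prod_unfold)
  also have "\<dots> = map_pmf fst (pair_pmf (random_subset A p) (random_subset (K - A) p))"
    using set_pmf_random_subset by (intro map_pmf_cong refl) fastforce
  finally show ?thesis
    by (simp add: map_fst_pair_pmf)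
qed

text \<open>Split \<open>K\<close> into \<open>K \<inter> A\<close> and \<open>K - A\<close>, whose
  chosen parts are independent. \<open>X\<close> reads only the first part, and \<open>Y\<close>
  only the second because \<open>B\<close> avoids \<open>A\<close>.\<close>

lemma random_subset_indep:
  assumes K: "finite K" and AB: "A \<inter> B = {}"
    and X: "\<And>E. E \<subseteq> K \<Longrightarrow> X E \<longleftrightarrow> X (E \<inter> A)" and Y: "\<And>E. E \<subseteq> K \<Longrightarrow> Y E \<longleftrightarrow> Y (E \<inter> B)"
  shows "measure_pmf.prob (random_subset K p) {E. X E \<and> Y E} =
    measure_pmf.prob (random_subset K p) {E. X E} * measure_pmf.prob (random_subset K p) {E. Y E}"
proof -
  define P where "P = pair_pmf (random_subset (K \<inter> A) p) (random_subset (K - A) p)"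
  have eq: "random_subset K p = map_pmf (\<lambda>(X, Y). X \<union> Y) P"
    unfolding P_def using random_subset_union[of "K \<inter> A" "K - A" p] K
    by (simp add: Int_Diff_Un Int_Diff_disjoint)
  have X': "X (E1 \<union> E2) = X E1" and Y': "Y (E1 \<union> E2) = Y E2"
    if E: "E1 \<subseteq> K \<inter> A" "E2 \<subseteq> K - A" for E1 E2
  proof -
    have "X (E1 \<union> E2) = X ((E1 \<union> E2) \<inter> A)" "X E1 = X (E1 \<inter> A)"
      using E by (intro X; auto)+
    moreover have "(E1 \<union> E2) \<inter> A = E1 \<inter> A" using E by auto
    ultimately show "X (E1 \<union> E2) = X E1" by simp
    have "Y (E1 \<union> E2) = Y ((E1 \<union> E2) \<inter> B)" "Y E2 = Y (E2 \<inter> B)"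
      using E by (intro Y; auto)+
    moreover have "(E1 \<union> E2) \<inter> B = E2 \<inter> B" using E AB by auto
    ultimately show "Y (E1 \<union> E2) = Y E2" by simp
  qed
  have supp: "fst z \<subseteq> K \<inter> A" "snd z \<subseteq> K - A" if "z \<in> set_pmf P" for z
    using that subsetD[OF set_pmf_random_subset] by (fastforce simp: P_def)+
  have "measure_pmf.prob (random_subset K p) {E. X E \<and> Y E} = measure_pmf.prob P ({E. X E} \<times> {E. Y E})"
    unfolding eq measure_map_pmf using supp X' Y'
    by (intro prob_cong_on_support) (auto simp: case_prod_unfold)
  moreover have "measure_pmf.prob (random_subset K p) {E. X E} = measure_pmf.prob P ({E. X E} \<times> UNIV)"
    unfolding eq measure_map_pmf using supp X'
    by (intro prob_cong_on_support) (auto simp: case_prod_unfold)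
  moreover have "measure_pmf.prob (random_subset K p) {E. Y E} = measure_pmf.prob P (UNIV \<times> {E. Y E})"
    unfolding eq measure_map_pmf using supp Y'
    by (intro prob_cong_on_support) (auto simp: case_prod_unfold)
  ultimately show ?thesis
    unfolding P_def prob_pair_times by simp
qed

lemma prob_random_subset_disjoint:
  assumes "finite K" "A \<subseteq> K" "0 \<le> p" "p \<le> 1"
  shows "measure_pmf.prob (random_subset K p) {E. E \<inter> A = {}} = (1 - p) ^ card A"
proof -
  have [simp]: "finite A" using assms finite_subset by auto
  have "measure_pmf.prob (random_subset K p) {E. E \<inter> A = {}} = measure_pmf.prob (random_subset A p) {{}}"
    unfolding random_subset_marginal[OF assms(1,2), symmetric] measure_map_pmf by (simp add: vimage_def)
  also have "\<dots> = measure_pmf.prob (Pi_pmf A False (\<lambda>_. bernoulli_pmf p)) (Pi A (\<lambda>_. {False}))"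
    unfolding random_subset_def measure_map_pmf by (intro arg_cong[of _ _ "measure_pmf.prob _"]) auto
  also have "\<dots> = (1 - p) ^ card A"
    using assms by (simp add: measure_Pi_pmf_Pi measure_pmf_single)
  finally show ?thesis .
qed

lemma prob_random_subset_contains:
  assumes "finite K" "A \<subseteq> K" "0 \<le> p" "p \<le> 1"
  shows "measure_pmf.prob (random_subset K p) {E. A \<subseteq> E} = p ^ card A"
proof -
  have [simp]: "finite A" using assms finite_subset by auto
  have "measure_pmf.prob (random_subset K p) {E. A \<subseteq> E} = measure_pmf.prob (random_subset A p) {E. A \<subseteq> E}"
    unfolding random_subset_marginal[OF assms(1,2), symmetric] measure_map_pmf by (simp add: vimage_def)
  also have "\<dots> = measure_pmf.prob (Pi_pmf A False (\<lambda>_. bernoulli_pmf p)) (Pi A (\<lambda>_. {True}))"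
    unfolding random_subset_def measure_map_pmf by (intro arg_cong[of _ _ "measure_pmf.prob _"]) auto
  also have "\<dots> = p ^ card A"
    using assms by (simp add: measure_Pi_pmf_Pi measure_pmf_single)
  finally show ?thesis .
qed

lemma bool_pmf_eqI:
  assumes "pmf M False = pmf N False"
  shows "M = N"
proof (rule pmf_eqI)
  have "pmf L True = 1 - pmf L False" for L :: "bool pmf"
  proof -
    have "sum (pmf L) UNIV = 1" by (rule sum_pmf_eq_1) auto
    then show ?thesis by (simp add: UNIV_bool)
  qed
  then show "pmf M b = pmf N b" for b
    using assms by (cases b) auto
qed

lemma Collect_insert_split: "{x \<in> insert a A. P x} = (if P a then {a} else {}) \<union> {x \<in> A. P x}"
  by auto

text \<open>In the application \<open>B f\<close> consists of the pairs joining a vertex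
  \<open>f\<close> to a set of \<open>a\<close> vertices, so that a neighbourhood becomes a random
  subset with its own density. Blocks are split off one at a time; each is missed with probability
  \<open>(1 - p) ^ a\<close>.\<close>

lemma random_subset_blocks:
  assumes F: "finite F" and B: "\<And>f. f \<in> F \<Longrightarrow> finite (B f) \<and> card (B f) = a"
    and disj: "\<And>f g. f \<in> F \<Longrightarrow> g \<in> F \<Longrightarrow> f \<noteq> g \<Longrightarrow> B f \<inter> B g = {}"
    and p: "0 \<le> p" "p \<le> 1" and K: "finite K" "(\<Union>f\<in>F. B f) \<subseteq> K"
  shows "map_pmf (\<lambda>E. {f \<in> F. E \<inter> B f \<noteq> {}}) (random_subset K p) = random_subset F (1 - (1 - p) ^ a)"
proof -
  let ?q = "1 - (1 - p) ^ a"
  have q: "0 \<le> ?q" "?q \<le> 1"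
    using p by (auto simp: power_le_one)
  have "map_pmf (\<lambda>E. {f \<in> F. E \<inter> B f \<noteq> {}}) (random_subset (\<Union>f\<in>F. B f) p) = random_subset F ?q"
    using F B disj
  proof (induction F)
    case (insert f F)
    have dis: "B f \<inter> (\<Union>g\<in>F. B g) = {}"
      using insert.hyps insert.prems(2) by fastforce
    have "map_pmf (\<lambda>E. E \<inter> B f \<noteq> {}) (random_subset (B f) p) = bernoulli_pmf ?q"
    proof (rule bool_pmf_eqI)
      have "pmf (map_pmf (\<lambda>E. E \<inter> B f \<noteq> {}) (random_subset (B f) p)) False =
          measure_pmf.prob (random_subset (B f) p) {E. E \<inter> B f = {}}"
        by (simp add: pmf_map vimage_def)
      also have "\<dots> = (1 - p) ^ a"
        using insert.prems p by (subst prob_random_subset_disjoint) auto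
      finally show "pmf (map_pmf (\<lambda>E. E \<inter> B f \<noteq> {}) (random_subset (B f) p)) False = pmf (bernoulli_pmf ?q) False"
        using q by simp
    qed
    then have "map_pmf (\<lambda>E. E \<inter> B f \<noteq> {}) (random_subset (B f) p) = map_pmf (\<lambda>E. E \<inter> {f} \<noteq> {}) (random_subset {f} ?q)"
      using q by (intro bool_pmf_eqI)
        (simp add: pmf_map vimage_def prob_random_subset_disjoint[of "{f}" "{f}" ?q, simplified])
    then have "map_pmf (\<lambda>b. if b then {f} else {}) (map_pmf (\<lambda>E. E \<inter> B f \<noteq> {}) (random_subset (B f) p)) =
        map_pmf (\<lambda>b. if b then {f} else {}) (map_pmf (\<lambda>E. E \<inter> {f} \<noteq> {}) (random_subset {f} ?q))"
      by simp
    also have "\<dots> = map_pmf (\<lambda>E. E) (random_subset {f} ?q)"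
      unfolding map_pmf_comp using set_pmf_random_subset[of "{f}" ?q] by (intro map_pmf_cong) auto
    finally have one: "random_subset {f} ?q = map_pmf (\<lambda>E. if E \<inter> B f \<noteq> {} then {f} else {}) (random_subset (B f) p)"
      by (simp add: map_pmf_comp)
    have "random_subset (insert f F) ?q = map_pmf (\<lambda>(X, Y). X \<union> Y) (pair_pmf (random_subset {f} ?q) (random_subset F ?q))"
      using random_subset_union[of "{f}" F ?q] insert.hyps by simp
    also have "\<dots> = map_pmf (\<lambda>(X, Y). (if X \<inter> B f \<noteq> {} then {f} else {}) \<union> {g \<in> F. Y \<inter> B g \<noteq> {}})
        (pair_pmf (random_subset (B f) p) (random_subset (\<Union>g\<in>F. B g) p))"
      unfolding one using insert.IH[symmetric] insert.prems
      by (simp add: pair_map_pmf1 pair_map_pmf2 map_pmf_comp case_prod_unfold apfst_def apsnd_def)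
    also have "\<dots> = map_pmf (\<lambda>(X, Y). {g \<in> insert f F. (X \<union> Y) \<inter> B g \<noteq> {}})
        (pair_pmf (random_subset (B f) p) (random_subset (\<Union>g\<in>F. B g) p))"
    proof (intro map_pmf_cong refl)
      fix z assume "z \<in> set_pmf (pair_pmf (random_subset (B f) p) (random_subset (\<Union>g\<in>F. B g) p))"
      then obtain X Y where z: "z = (X, Y)" "X \<subseteq> B f" "Y \<subseteq> (\<Union>g\<in>F. B g)"
        by (cases z) (auto dest!: subsetD[OF set_pmf_random_subset])
      have "(X \<union> Y) \<inter> B f = X \<inter> B f" using z dis by auto
      moreover have "(X \<union> Y) \<inter> B g = Y \<inter> B g" if "g \<in> F" for g
        using z dis that by auto
      ultimately show "(case z of (X, Y) \<Rightarrow> (if X \<inter> B f \<noteq> {} then {f} else {}) \<union> {g \<in> F. Y \<inter> B g \<noteq> {}}) =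
          (case z of (X, Y) \<Rightarrow> {g \<in> insert f F. (X \<union> Y) \<inter> B g \<noteq> {}})"
        unfolding z prod.case Collect_insert_split by (simp cong: conj_cong)
    qed
    also have "\<dots> = map_pmf (\<lambda>E. {g \<in> insert f F. E \<inter> B g \<noteq> {}}) (random_subset (\<Union>g\<in>insert f F. B g) p)"
      using random_subset_union[of "B f" "\<Union>g\<in>F. B g" p] dis insert.hyps insert.prems
      by (simp add: map_pmf_comp case_prod_unfold)
    finally show ?case by simp
  qed simp
  moreover have "random_subset (\<Union>f\<in>F. B f) p = map_pmf (\<lambda>E. E \<inter> (\<Union>f\<in>F. B f)) (random_subset K p)"
    using K by (simp add: random_subset_marginal)
  moreover have "E \<inter> (\<Union>f\<in>F. B f) \<inter> B f = E \<inter> B f" if "f \<in> F" for E f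
    using that by auto
  ultimately show ?thesis
    by (simp add: map_pmf_comp cong: conj_cong)
qed

section \<open>Tail bounds for the binomial distribution\<close>

lemma card_random_subset:
  assumes "finite F" "0 \<le> q" "q \<le> 1"
  shows "map_pmf card (random_subset F q) = binomial_pmf (card F) q"
  using assms by (subst binomial_pmf_altdef'[where A = F and dflt = False]) (auto simp: random_subset_def map_pmf_comp)

lemma binomial_mgf:
  assumes "0 \<le> q" "q \<le> 1"
  shows "measure_pmf.expectation (binomial_pmf n q) (\<lambda>x. exp (\<theta> * real x)) = (1 + q * (exp \<theta> - 1)) ^ n"
proof -
  have "measure_pmf.expectation (binomial_pmf n q) (\<lambda>x. exp (\<theta> * real x)) =
      (\<Sum>k\<le>n. (real (n choose k) * q ^ k * (1 - q) ^ (n - k)) *\<^sub>R exp (\<theta> * real k))"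
    using assms by (subst expectation_binomial_pmf') auto
  also have "\<dots> = (\<Sum>k\<le>n. real (n choose k) * (q * exp \<theta>) ^ k * (1 - q) ^ (n - k))"
    by (intro sum.cong) (auto simp: power_mult_distrib exp_of_nat_mult[symmetric] mult.commute)
  also have "\<dots> = (q * exp \<theta> + (1 - q)) ^ n"
    by (simp add: binomial_ring)
  finally show ?thesis by (simp add: algebra_simps)
qed

text \<open>Markov's inequality for the exponential moment, followed by
  \<open>1 + z \<le> exp z\<close>. The sign of \<open>\<theta>\<close> is free, so both tails
  follow from it.\<close>

lemma binomial_markov:
  assumes q: "0 \<le> q" "q \<le> 1"
  shows "measure_pmf.prob (binomial_pmf n q) {x. t \<le> \<theta> * real x} \<le> exp (real n * q * (exp \<theta> - 1) - t)"
proof -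
  let ?M = "binomial_pmf n q"
  have fin: "finite (set_pmf ?M)" using q by auto
  have "measure_pmf.prob ?M {x. t \<le> \<theta> * real x} = measure_pmf.prob ?M {x \<in> space ?M. exp t \<le> exp (\<theta> * real x)}"
    by simp
  also have "\<dots> \<le> measure_pmf.expectation ?M (\<lambda>x. exp (\<theta> * real x)) / exp t"
    using fin by (intro integral_Markov_inequality_measure[where A = UNIV])
      (auto intro: integrable_measure_pmf_finite)
  also have "\<dots> = (1 + q * (exp \<theta> - 1)) ^ n / exp t"
    by (simp add: binomial_mgf q)
  also have "\<dots> \<le> exp (q * (exp \<theta> - 1)) ^ n / exp t"
  proof (intro divide_right_mono power_mono)
    show "1 + q * (exp \<theta> - 1) \<le> exp (q * (exp \<theta> - 1))" by (rule exp_ge_add_one_self)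
    have "0 \<le> (1 - q) + q * exp \<theta>" using q by simp
    then show "0 \<le> 1 + q * (exp \<theta> - 1)" by (simp add: algebra_simps)
  qed simp
  also have "\<dots> = exp (real n * q * (exp \<theta> - 1) - t)"
    by (simp add: exp_diff exp_of_nat_mult[symmetric] mult.assoc)
  finally show ?thesis .
qed

text \<open>Take \<open>\<theta> = \<delta> / 2\<close> and use
  \<open>exp y - 1 \<le> y + y\<^sup>2\<close> at \<open>y = \<delta> / 2\<close>. The mean only has
  to be at most \<open>\<mu>\<close>, which suits levels whose size is merely bounded above.\<close>

lemma binomial_upper_tail:
  assumes q: "0 \<le> q" "q \<le> 1" and \<mu>: "real n * q \<le> \<mu>" and \<delta>: "0 \<le> \<delta>" "\<delta> \<le> 1"
  shows "measure_pmf.prob (binomial_pmf n q) {x. real x > (1 + \<delta>) * \<mu>} \<le> exp (- \<delta>\<^sup>2 * \<mu> / 4)"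
proof -
  have "measure_pmf.prob (binomial_pmf n q) {x. real x > (1 + \<delta>) * \<mu>} \<le>
      measure_pmf.prob (binomial_pmf n q) {x. \<delta> / 2 * ((1 + \<delta>) * \<mu>) \<le> \<delta> / 2 * real x}"
    using \<delta> by (intro measure_pmf.finite_measure_mono) (auto intro: mult_left_mono)
  also have "\<dots> \<le> exp (real n * q * (exp (\<delta> / 2) - 1) - \<delta> / 2 * ((1 + \<delta>) * \<mu>))"
    by (intro binomial_markov q)
  also have "\<dots> \<le> exp (- \<delta>\<^sup>2 * \<mu> / 4)"
  proof -
    have "exp (\<delta> / 2) - 1 \<le> \<delta> / 2 + (\<delta> / 2)\<^sup>2"
      using exp_bound[of "\<delta> / 2"] \<delta> by simp
    moreover have "0 \<le> exp (\<delta> / 2) - 1" using \<delta> by simp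
    moreover have "0 \<le> \<mu>" using \<mu> q by (smt (verit) mult_nonneg_nonneg of_nat_0_le_iff)
    ultimately have "real n * q * (exp (\<delta> / 2) - 1) \<le> \<mu> * (\<delta> / 2 + (\<delta> / 2)\<^sup>2)"
      using \<mu> by (intro mult_mono) auto
    then show ?thesis by (simp add: power2_eq_square algebra_simps add_divide_distrib)
  qed
  finally show ?thesis .
qed

text \<open>Both sides are compared with \<open>1 / (1 + x)\<close>, using
  \<open>(1 + x) * (1 - x + x\<^sup>2) = 1 + x ^ 3\<close>.\<close>

lemma exp_minus_le_quadratic:
  fixes x :: real
  assumes "0 \<le> x"
  shows "exp (- x) \<le> 1 - x + x\<^sup>2"
proof -
  have "exp (- x) \<le> 1 / (1 + x)"
    using exp_ge_add_one_self[of x] assms by (simp add: exp_minus field_simps)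
  also have "\<dots> \<le> 1 - x + x\<^sup>2"
    using assms by (simp add: field_simps power2_eq_square)
  finally show ?thesis .
qed

lemma binomial_lower_tail:
  assumes q: "0 \<le> q" "q \<le> 1" and \<mu>: "\<mu> \<le> real n * q" "0 \<le> \<mu>" and \<delta>: "0 \<le> \<delta>" "\<delta> \<le> 1"
  shows "measure_pmf.prob (binomial_pmf n q) {x. real x < (1 - \<delta>) * \<mu>} \<le> exp (- \<delta>\<^sup>2 * \<mu> / 4)"
proof -
  have "measure_pmf.prob (binomial_pmf n q) {x. real x < (1 - \<delta>) * \<mu>} \<le>
      measure_pmf.prob (binomial_pmf n q) {x. - \<delta> / 2 * ((1 - \<delta>) * \<mu>) \<le> (- \<delta> / 2) * real x}"
    using \<delta> by (intro measure_pmf.finite_measure_mono) (auto intro: mult_left_mono)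
  also have "\<dots> \<le> exp (real n * q * (exp (- \<delta> / 2) - 1) - (- \<delta> / 2 * ((1 - \<delta>) * \<mu>)))"
    by (intro binomial_markov q)
  also have "\<dots> \<le> exp (- \<delta>\<^sup>2 * \<mu> / 4)"
  proof -
    have "exp (- \<delta> / 2) - 1 \<le> - (\<delta> / 2) + (\<delta> / 2)\<^sup>2"
      using exp_minus_le_quadratic[of "\<delta> / 2"] \<delta> by simp
    \<comment> \<open>This makes \<open>- (\<delta> / 2) + (\<delta> / 2)\<^sup>2\<close>
      nonpositive, so the mean may be replaced by its lower bound \<open>\<mu>\<close>.\<close>
    moreover have "(\<delta> / 2)\<^sup>2 \<le> \<delta> / 2" 
      using \<delta> mult_left_le[of \<delta> \<delta>] by (simp add: power2_eq_square)
    ultimately have "real n * q * (exp (- \<delta> / 2) - 1) \<le> \<mu> * (- (\<delta> / 2) + (\<delta> / 2)\<^sup>2)"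
      using \<mu> q by (smt (verit) mult_left_mono mult_right_mono_neg mult_nonneg_nonneg of_nat_0_le_iff)
    then show ?thesis by (simp add: power2_eq_square field_simps)
  qed
  finally show ?thesis .
qed

subsection \<open>Breadth-first exploration\<close>

definition nbr :: "'a set set \<Rightarrow> 'a set \<Rightarrow> 'a set \<Rightarrow> 'a set" where
  "nbr E A F = {f \<in> F. \<exists>a\<in>A. {a, f} \<in> E}"

text \<open>Removing \<open>f\<close> keeps the inner vertices distinct. The number of edges is
  exactly \<open>r + 1\<close>; for \<open>r = k - 2\<close> this is the greatest length forbidden
  between edges of a \<open>k\<close>-matching, and the one that the upper bound exploits.\<close>

fun has_path :: "nat \<Rightarrow> 'a set \<Rightarrow> 'a set \<Rightarrow> 'a set \<Rightarrow> 'a set set \<Rightarrow> bool" where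
  "has_path 0 A F T E \<longleftrightarrow> (\<exists>a\<in>A. \<exists>t\<in>T. {a, t} \<in> E)"
| "has_path (Suc r) A F T E \<longleftrightarrow> (\<exists>a\<in>A. \<exists>f\<in>F. {a, f} \<in> E \<and> has_path r {f} (F - {f}) T E)"

lemma has_path_cong:
  assumes "\<And>a x. a \<in> A \<union> F \<Longrightarrow> x \<in> F \<union> T \<Longrightarrow> {a, x} \<in> E \<longleftrightarrow> {a, x} \<in> E'"
  shows "has_path r A F T E \<longleftrightarrow> has_path r A F T E'"
  using assms
proof (induction r arbitrary: A F)
  case 0
  then show ?case by auto
next
  case (Suc r)
  have "has_path r {f} (F - {f}) T E \<longleftrightarrow> has_path r {f} (F - {f}) T E'" if "f \<in> F" for f
    using that by (intro Suc.IH Suc.prems) auto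
  with Suc.prems show ?case by (auto 4 4)
qed

lemma has_path_mono: "has_path r A F T E \<Longrightarrow> A \<subseteq> A' \<Longrightarrow> F \<subseteq> F' \<Longrightarrow> has_path r A' F' T E"
proof (induction r arbitrary: A F A' F')
  case 0
  then show ?case by auto
next
  case (Suc r)
  then obtain a f where af: "a \<in> A" "f \<in> F" "{a, f} \<in> E" "has_path r {f} (F - {f}) T E" by auto
  have "has_path r {f} (F' - {f}) T E"
    by (rule Suc.IH[OF af(4)]) (use Suc.prems in auto)
  with af Suc.prems show ?case by auto
qed

lemma has_path_iff_singleton: "has_path r A F T E \<longleftrightarrow> (\<exists>a\<in>A. has_path r {a} F T E)"
  by (cases r) auto

text \<open>This turns one exploration level into one edge of a path. \<open>X\<close> may be a
  proper part of the neighbourhood, since the exploration keeps only a prescribed number of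
  vertices; discarding all of \<open>X\<close> from \<open>F\<close> is harmless by
  monotonicity.\<close>

lemma has_path_Suc_nbr:
  assumes "has_path r X (F - X) T E" "X \<subseteq> nbr E A F"
  shows "has_path (Suc r) A F T E"
proof -
  obtain x where x: "x \<in> X" "has_path r {x} (F - X) T E"
    using assms(1) has_path_iff_singleton by metis
  then have "has_path r {x} (F - {x}) T E"
    by (elim has_path_mono) auto
  moreover obtain a where "a \<in> A" "{a, x} \<in> E" "x \<in> F"
    using x(1) assms(2) by (auto simp: nbr_def)
  ultimately show ?thesis by auto
qed

text \<open>
  No path of exactly \<open>r + 1\<close> edges joins two of the listed sets through \<open>F\<close>. Requiring this only
  from each set to the later ones matches the order of the exploration.
\<close>

fun separated :: "nat \<Rightarrow> 'a set list \<Rightarrow> 'a set \<Rightarrow> 'a set set \<Rightarrow> bool" where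
  "separated r [] F E \<longleftrightarrow> True"
| "separated r (e # es) F E \<longleftrightarrow> \<not> has_path r e F (\<Union>(set es)) E \<and> separated r es F E"

lemma separated_antimono: "separated r es F E \<Longrightarrow> F' \<subseteq> F \<Longrightarrow> separated r es F' E"
  by (induction es) (auto dest: has_path_mono[OF _ order_refl])

text \<open>A path that is tested starts in one set, runs through \<open>F\<close> and ends in a
  different set, so it never uses a pair inside a listed set. This later makes the presence of the
  matching edges independent of their separation.\<close>

lemma separated_cong:
  assumes "distinct es" "pairwise disjnt (set es)" "F \<inter> \<Union>(set es) = {}"
    and "\<And>a x. a \<in> F \<union> \<Union>(set es) \<Longrightarrow> x \<in> F \<union> \<Union>(set es) \<Longrightarrow>
      (\<And>e. e \<in> set es \<Longrightarrow> a \<in> e \<Longrightarrow> x \<notin> e) \<Longrightarrow> {a, x} \<in> E \<longleftrightarrow> {a, x} \<in> E'"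
  shows "separated r es F E \<longleftrightarrow> separated r es F E'"
  using assms
proof (induction es)
  case (Cons e es)
  have dis: "disjnt e e'" if "e' \<in> set es" for e'
    using Cons.prems that by (auto simp: pairwise_def)
  have "has_path r e F (\<Union>(set es)) E \<longleftrightarrow> has_path r e F (\<Union>(set es)) E'"
  proof (rule has_path_cong)
    fix a x assume ax: "a \<in> e \<union> F" "x \<in> F \<union> \<Union>(set es)"
    show "{a, x} \<in> E \<longleftrightarrow> {a, x} \<in> E'"
    proof (rule Cons.prems(4))
      show "x \<notin> e'" if "e' \<in> set (e # es)" "a \<in> e'" for e'
        using ax that dis Cons.prems(3) by (auto simp: disjnt_iff)
    qed (use ax in auto)
  qed
  moreover have "separated r es F E \<longleftrightarrow> separated r es F E'"
  proof (rule Cons.IH)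
    fix a x assume ax: "a \<in> F \<union> \<Union>(set es)" "x \<in> F \<union> \<Union>(set es)"
      "\<And>e. e \<in> set es \<Longrightarrow> a \<in> e \<Longrightarrow> x \<notin> e"
    show "{a, x} \<in> E \<longleftrightarrow> {a, x} \<in> E'"
    proof (rule Cons.prems(4))
      show "x \<notin> e'" if "e' \<in> set (e # es)" "a \<in> e'" for e'
        using ax that dis Cons.prems(3) by (auto simp: disjnt_iff)
    qed (use ax in auto)
  qed (use Cons.prems in \<open>auto simp: pairwise_def\<close>)
  ultimately show ?case by simp
qed simp

lemma separated_local:
  "separated r es F E \<longleftrightarrow> separated r es F (E \<inter> Pow (F \<union> \<Union>(set es)))"
proof (induction es arbitrary: E)
  case (Cons e es)
  have "has_path r e F (\<Union>(set es)) E \<longleftrightarrow>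
      has_path r e F (\<Union>(set es)) (E \<inter> Pow (F \<union> \<Union>(set (e # es))))"
    by (rule has_path_cong) auto
  moreover have "E \<inter> Pow (F \<union> \<Union>(set (e # es))) \<inter> Pow (F \<union> \<Union>(set es)) = E \<inter> Pow (F \<union> \<Union>(set es))"
    by auto
  ultimately show ?case
    using Cons.IH[of E] Cons.IH[of "E \<inter> Pow (F \<union> \<Union>(set (e # es)))"] by simp
qed simp

text \<open>Breadth-first rounds: for disjoint \<open>A\<close> and \<open>F\<close>, what remains
  are the vertices of \<open>F\<close> at distance more than \<open>r\<close> from \<open>A\<close>
  in the graph induced on \<open>A \<union> F\<close>. Only the newest level is carried along, since
  older levels have no neighbours left in \<open>F\<close>.\<close>

fun unreached :: "nat \<Rightarrow> 'a set \<Rightarrow> 'a set \<Rightarrow> 'a set set \<Rightarrow> 'a set" where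
  "unreached 0 A F E = F"
| "unreached (Suc r) A F E = unreached r (nbr E A F) (F - nbr E A F) E"

lemma unreached_subset: "unreached r A F E \<subseteq> F"
  by (induction r arbitrary: A F) fastforce+

lemma nbr_local: "nbr E A F = nbr (E \<inter> {e. \<exists>a\<in>A. \<exists>f\<in>F. e = {a, f}}) A F"
  by (auto simp: nbr_def)

lemma unreached_local: "A \<union> F \<subseteq> W \<Longrightarrow> unreached r A F E = unreached r A F (E \<inter> Pow W)"
proof (induction r arbitrary: A F)
  case (Suc r)
  have "nbr (E \<inter> Pow W) A F = nbr E A F" using Suc.prems by (auto simp: nbr_def)
  moreover have "nbr E A F \<union> (F - nbr E A F) \<subseteq> W" using Suc.prems by (auto simp: nbr_def)
  note Suc.IH[OF this]
  ultimately show ?case by simp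
qed simp

definition edge_free :: "'a set set \<Rightarrow> 'a set \<Rightarrow> bool" where
  "edge_free E U \<longleftrightarrow> (\<forall>e\<in>E. \<not> e \<subseteq> U)"

lemma edge_free_local: "U \<subseteq> W \<Longrightarrow> edge_free E U \<longleftrightarrow> edge_free (E \<inter> Pow W) U"
  unfolding edge_free_def by blast

subsection \<open>Distance matchings and exploration\<close>

text \<open>The disjointness assumptions make the traced vertices distinct, as
  \<open>path_between\<close> demands; \<open>r + 1\<close> edges correspond to a list of
  \<open>r + 2\<close> vertices.\<close>

lemma has_path_imp_path:
  assumes "has_path r A F T E" "A \<inter> (F \<union> T) = {}" "F \<inter> T = {}"
  shows "\<exists>a\<in>A. \<exists>t\<in>T. \<exists>xs. path_between E a t xs \<and> length xs = r + 2 \<and> set xs \<subseteq> {a} \<union> F \<union> T"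
  using assms
proof (induction r arbitrary: A F)
  case 0
  then obtain a t where "a \<in> A" "t \<in> T" "{a, t} \<in> E" by auto
  moreover from this have "path_between E a t [a, t]"
    using 0 by (auto simp: path_between_def)
  ultimately show ?case by fastforce
next
  case (Suc r)
  then obtain a f where af: "a \<in> A" "f \<in> F" "{a, f} \<in> E" "has_path r {f} (F - {f}) T E" by auto
  have "{f} \<inter> (F - {f} \<union> T) = {}" "(F - {f}) \<inter> T = {}" using af Suc.prems by auto
  from Suc.IH[OF af(4) this] obtain t xs
    where xs: "t \<in> T" "path_between E f t xs" "length xs = r + 2" "set xs \<subseteq> {f} \<union> (F - {f}) \<union> T"
    by auto
  have "path_between E a t (a # xs)"
    using xs af Suc.prems by (auto simp: path_between_def successively_Cons)
  then show ?case using xs af by fastforce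
qed

text \<open>For \<open>r = k - 2\<close> a path found by \<open>has_path\<close> has
  \<open>k - 1\<close> edges, one fewer than the distance required between two matching
  edges.\<close>

lemma k_matching_separated:
  assumes "k \<ge> 2" "k_matching k E M" "set es \<subseteq> M" "distinct es" "F \<inter> \<Union>(set es) = {}"
  shows "separated (k - 2) es F E"
  using assms(3-)
proof (induction es)
  case (Cons e es)
  have far: "u \<noteq> v \<and> graph_dist E u v \<ge> enat k" if "f \<in> set es" "u \<in> e" "v \<in> f" for f u v
    using assms(2) Cons.prems that unfolding k_matching_def by (metis distinct.simps(2) list.set_intros subsetD)
  have "\<not> has_path (k - 2) e F (\<Union>(set es)) E"
  proof
    assume *: "has_path (k - 2) e F (\<Union>(set es)) E"
    have "e \<inter> (F \<union> \<Union>(set es)) = {}" "F \<inter> \<Union>(set es) = {}"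
      using Cons.prems far by fastforce+
    from has_path_imp_path[OF * this] obtain u v xs f
      where xs: "u \<in> e" "f \<in> set es" "v \<in> f" "path_between E u v xs" "length xs = k"
      using assms(1) by auto
    have "graph_dist E u v \<le> enat (length xs - 1)"
      unfolding graph_dist_def using xs(4) by (intro INF_lower) auto
    then have "enat k \<le> enat (k - 1)"
      using far[OF xs(2,1,3)] xs(5) order_trans by metis
    then show False using assms(1) by simp
  qed
  with Cons show ?case by auto
qed simp

text \<open>Crossing one edge changes the round of discovery by at most one: a neighbour of
  \<open>A\<close> or of a later level is reached at most one round after it.\<close>

lemma unreached_step:
  assumes "x \<in> unreached (Suc r) A F E" "{y, x} \<in> E" "y \<in> A \<union> F"
  shows "y \<in> unreached r A F E"
  using assms
proof (induction r arbitrary: A F)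
  case 0
  then show ?case by (auto simp: nbr_def)
next
  case (Suc r)
  let ?A = "nbr E A F" and ?F = "F - nbr E A F"
  have x: "x \<in> unreached (Suc r) ?A ?F E" using Suc.prems(1) by (simp only: unreached.simps)
  then have "x \<in> ?F" by (rule subsetD[OF unreached_subset])
  then have "y \<in> ?A \<union> ?F" using Suc.prems by (auto simp: nbr_def)
  from Suc.IH[OF x Suc.prems(2) this] show ?case by simp
qed

text \<open>Iterating \<open>unreached_step\<close> spends one round per edge, and
  \<open>length xs \<le> Suc r\<close> means at most \<open>r\<close> edges.\<close>

lemma unreached_walk:
  assumes "successively (\<lambda>x y. {x, y} \<in> E) xs" "xs \<noteq> []" "hd xs \<in> unreached r A F E"
    "set xs \<subseteq> A \<union> F" "length xs \<le> Suc r"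
  shows "last xs \<in> F"
  using assms
proof (induction xs arbitrary: r)
  case (Cons x xs)
  show ?case
  proof (cases xs)
    case Nil
    then show ?thesis using Cons.prems(3) subsetD[OF unreached_subset[of r A F E]] by simp
  next
    case (Cons y ys)
    with Cons.prems obtain r' where r: "r = Suc r'" by (cases r) auto
    have "y \<in> unreached r' A F E"
    proof (rule unreached_step)
      show "x \<in> unreached (Suc r') A F E" using Cons.prems(3) r by (simp only: list.sel)
      have "{x, y} \<in> E" using Cons.prems(1) Cons by simp
      then show "{y, x} \<in> E" by (metis insert_commute)
      show "y \<in> A \<union> F" using Cons.prems(4) Cons by simp
    qed
    have "last xs \<in> F"
    proof (rule Cons.IH)
      show "successively (\<lambda>x y. {x, y} \<in> E) xs" using Cons.prems(1) Cons by simp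
      show "hd xs \<in> unreached r' A F E" using \<open>y \<in> _\<close> Cons by simp
      show "length xs \<le> Suc r'" using Cons.prems(5) r by simp
      show "xs \<noteq> []" using Cons by simp
      show "set xs \<subseteq> A \<union> F" using Cons.prems(4) by simp
    qed
    then show ?thesis using Cons by simp
  qed
qed simp

lemma walk_in_vertices:
  assumes "successively (\<lambda>x y. {x, y} \<in> E) xs" "xs \<noteq> []" "hd xs \<in> V" "E \<subseteq> [V]\<^bsup>2\<^esup>"
  shows "set xs \<subseteq> V"
  using assms
proof (induction xs)
  case (Cons x xs)
  show ?case
  proof (cases xs)
    case (Cons y ys)
    then have "{x, y} \<in> E" using Cons.prems(1) by simp
    then have "{x, y} \<in> [V]\<^bsup>2\<^esup>" using Cons.prems(4) by blast
    then have "y \<in> V" by simp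
    then show ?thesis using Cons Cons.prems Cons.IH by simp
  qed (use Cons.prems in simp)
qed simp

text \<open>By \<open>unreached_walk\<close>, a walk from \<open>u\<close> with at most
  \<open>k - 1\<close> edges ends outside \<open>S\<close>. Both orders of the arguments are wanted
  because \<open>k_matching\<close> quantifies over ordered pairs; reversing paths gives the
  second.\<close>

lemma unreached_far:
  assumes E: "E \<subseteq> [V]\<^bsup>2\<^esup>" and S: "S \<subseteq> V" and k: "k \<ge> 1"
    and u: "u \<in> unreached (k - 1) S (V - S) E" and v: "v \<in> S"
  shows "graph_dist E u v \<ge> enat k" "graph_dist E v u \<ge> enat k"
proof -
  have long: "k \<le> length xs - 1"
    if "successively (\<lambda>x y. {x, y} \<in> E) xs" "xs \<noteq> []" "hd xs = u" "last xs = v" for xs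
  proof (rule ccontr)
    assume "\<not> k \<le> length xs - 1"
    moreover have "u \<in> V" using subsetD[OF unreached_subset u] by simp
    ultimately have "last xs \<in> V - S"
      using that u k S walk_in_vertices[OF that(1,2) _ E]
      by (intro unreached_walk[of E xs "k - 1" S]) auto
    then show False using that v by simp
  qed
  show "graph_dist E u v \<ge> enat k"
    unfolding graph_dist_def path_between_def using long by (intro INF_greatest) auto
  show "graph_dist E v u \<ge> enat k"
    unfolding graph_dist_def path_between_def
  proof (intro INF_greatest)
    fix xs assume "xs \<in> {xs. xs \<noteq> [] \<and> hd xs = v \<and> last xs = u \<and> distinct xs \<and> successively (\<lambda>x y. {x, y} \<in> E) xs}"
    then have "successively (\<lambda>x y. {x, y} \<in> E) (rev xs)" "xs \<noteq> []" "hd xs = v" "last xs = u"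
      unfolding successively_rev by (auto elim!: successively_mono simp: insert_commute[of _ _ "{}"])
    then show "enat k \<le> enat (length xs - 1)"
      using long[of "rev xs"] by (simp add: hd_rev last_rev)
  qed
qed

text \<open>An edge inside the unreached set is at distance at least \<open>k\<close> from all of
  \<open>M\<close> and could be added. \<open>S\<close> may be larger than \<open>\<Union>M\<close>,
  so that the later union bound can range over sets of one fixed size.\<close>

lemma maximal_edge_free_unreached:
  assumes E: "E \<subseteq> [V]\<^bsup>2\<^esup>" and S: "S \<subseteq> V" "\<Union>M \<subseteq> S" and k: "k \<ge> 1" and M: "maximal_k_matching k E M"
  shows "edge_free E (unreached (k - 1) S (V - S) E)"
  unfolding edge_free_def
proof (intro ballI notI)
  fix e assume e: "e \<in> E" "e \<subseteq> unreached (k - 1) S (V - S) E"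
  have "e \<inter> S = {}" using e(2) unreached_subset[of "k - 1" S "V - S" E] by blast
  moreover have "e \<noteq> {}" using e E by (auto simp: nsets_def)
  ultimately have "e \<notin> M" using S by auto
  have far: "u \<noteq> v \<and> graph_dist E u v \<ge> enat k \<and> graph_dist E v u \<ge> enat k"
    if "u \<in> e" "f \<in> M" "v \<in> f" for u v f
    using that e S \<open>e \<inter> S = {}\<close> unreached_far[OF E S(1) k] by blast
  have "k_matching k E M" using M by (simp add: maximal_k_matching_def)
  have "k_matching k E (insert e M)"
    unfolding k_matching_def
  proof (intro conjI)
    show "insert e M \<subseteq> E" using e \<open>k_matching k E M\<close> by (simp add: k_matching_def)
    show "\<forall>e1\<in>insert e M. \<forall>e2\<in>insert e M. e1 \<noteq> e2 \<longrightarrow>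
        (\<forall>u\<in>e1. \<forall>v\<in>e2. u \<noteq> v \<and> graph_dist E u v \<ge> enat k)"
    proof (intro ballI impI)
      fix e1 e2 u v assume *: "e1 \<in> insert e M" "e2 \<in> insert e M" "e1 \<noteq> e2" "u \<in> e1" "v \<in> e2"
      then consider "e1 = e" "e2 \<in> M" | "e2 = e" "e1 \<in> M" | "e1 \<in> M" "e2 \<in> M" by auto
      then show "u \<noteq> v \<and> graph_dist E u v \<ge> enat k"
      proof cases
        case 1
        then show ?thesis using far[of u e2 v] * by auto
      next
        case 2
        then show ?thesis using far[of v e1 u] * by auto
      next
        case 3
        then show ?thesis using \<open>k_matching k E M\<close> * by (simp add: k_matching_def)
      qed
    qed
  qed
  then show False
    using M e \<open>e \<notin> M\<close> by (auto simp: maximal_k_matching_def)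
qed

subsection \<open>Exploring the random graph\<close>

locale gnp =
  fixes V :: "'a set" and p :: real
  assumes finV: "finite V" and p0: "0 \<le> p" and p1: "p \<le> 1"
begin

definition P :: "('a set set \<Rightarrow> bool) \<Rightarrow> real" where
  "P Q = measure_pmf.prob (random_subset ([V]\<^bsup>2\<^esup>) p) {E. Q E}"

lemma fin_pairs: "finite ([V]\<^bsup>2\<^esup>)"
  by (simp add: finV finite_imp_finite_nsets)

lemma P_nonneg: "0 \<le> P Q" and P_le_1: "P Q \<le> 1"
  by (simp_all add: P_def)

lemma P_mono: "(\<And>E. E \<subseteq> [V]\<^bsup>2\<^esup> \<Longrightarrow> Q E \<Longrightarrow> Q' E) \<Longrightarrow> P Q \<le> P Q'"
  unfolding P_def using set_pmf_random_subset by (intro prob_mono_on_support) blast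

lemma P_disj: "P (\<lambda>E. Q E \<or> Q' E) \<le> P Q + P Q'"
proof -
  have "{E. Q E \<or> Q' E} = {E. Q E} \<union> {E. Q' E}" by auto
  then show ?thesis unfolding P_def by (simp add: measure_Un_le)
qed

lemma P_union_bound:
  assumes "finite S" "\<And>s. s \<in> S \<Longrightarrow> P (Q s) \<le> \<beta>"
  shows "P (\<lambda>E. \<exists>s\<in>S. Q s E) \<le> real (card S) * \<beta>"
proof -
  have "P (\<lambda>E. \<exists>s\<in>S. Q s E) = measure_pmf.prob (random_subset ([V]\<^bsup>2\<^esup>) p) (\<Union>s\<in>S. {E. Q s E})"
    unfolding P_def by (intro arg_cong[of _ _ "measure_pmf.prob _"]) auto
  also have "\<dots> \<le> (\<Sum>s\<in>S. P (Q s))"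
    unfolding P_def by (intro measure_pmf.finite_measure_subadditive_finite) (use assms in auto)
  also have "\<dots> \<le> real (card S) * \<beta>"
    using assms(2) by (rule sum_bounded_above)
  finally show ?thesis .
qed

lemma P_indep:
  assumes "A \<inter> B = {}"
    and "\<And>E. E \<subseteq> [V]\<^bsup>2\<^esup> \<Longrightarrow> X E \<longleftrightarrow> X (E \<inter> A)" and "\<And>E. E \<subseteq> [V]\<^bsup>2\<^esup> \<Longrightarrow> Y E \<longleftrightarrow> Y (E \<inter> B)"
  shows "P (\<lambda>E. X E \<and> Y E) = P X * P Y"
  unfolding P_def by (intro random_subset_indep[where A = A and B = B] assms fin_pairs)

lemma P_disjoint: "A \<subseteq> [V]\<^bsup>2\<^esup> \<Longrightarrow> P (\<lambda>E. E \<inter> A = {}) = (1 - p) ^ card A"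
  unfolding P_def by (intro prob_random_subset_disjoint fin_pairs p0 p1)

lemma P_contains: "A \<subseteq> [V]\<^bsup>2\<^esup> \<Longrightarrow> P (\<lambda>E. A \<subseteq> E) = p ^ card A"
  unfolding P_def by (intro prob_random_subset_contains fin_pairs p0 p1)

lemma nbr_prob_bounds: "0 \<le> 1 - (1 - p) ^ a" "1 - (1 - p) ^ a \<le> 1"
  using p0 p1 by (auto simp: power_le_one)

text \<open>The pairs from one \<open>f\<close> to \<open>A\<close> form a block of size
  \<open>card A\<close>, and the blocks of different \<open>f\<close> are disjoint; hence the
  vertices of \<open>F\<close> are hit independently.\<close>

lemma P_card_nbr:
  assumes "A \<inter> F = {}" "A \<union> F \<subseteq> V"
  shows "P (\<lambda>E. R (card (nbr E A F))) =
    measure_pmf.prob (binomial_pmf (card F) (1 - (1 - p) ^ card A)) {x. R x}"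
proof -
  define B where "B f = (\<lambda>a. {a, f}) ` A" for f
  have fin: "finite A" "finite F" using assms(2) finV finite_subset by auto
  have nbr: "nbr E A F = {f \<in> F. E \<inter> B f \<noteq> {}}" for E
    by (auto simp: nbr_def B_def)
  have "map_pmf (\<lambda>E. nbr E A F) (random_subset ([V]\<^bsup>2\<^esup>) p) = random_subset F (1 - (1 - p) ^ card A)"
    unfolding nbr
  proof (rule random_subset_blocks[OF fin(2)])
    show "finite (B f) \<and> card (B f) = card A" if "f \<in> F" for f
      unfolding B_def using fin by (auto intro!: card_image inj_onI simp: doubleton_eq_iff)
    show "B f \<inter> B g = {}" if "f \<in> F" "g \<in> F" "f \<noteq> g" for f g
      using that assms(1) by (auto simp: B_def doubleton_eq_iff)
    show "(\<Union>f\<in>F. B f) \<subseteq> [V]\<^bsup>2\<^esup>"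
      using assms by (auto simp: B_def)
  qed (use p0 p1 fin_pairs in auto)
  then have *: "map_pmf card (map_pmf (\<lambda>E. nbr E A F) (random_subset ([V]\<^bsup>2\<^esup>) p)) =
      binomial_pmf (card F) (1 - (1 - p) ^ card A)"
    by (simp only: card_random_subset[OF fin(2) nbr_prob_bounds])
  have "P (\<lambda>E. R (card (nbr E A F))) =
      measure_pmf.prob (map_pmf card (map_pmf (\<lambda>E. nbr E A F) (random_subset ([V]\<^bsup>2\<^esup>) p))) {x. R x}"
    by (simp add: P_def vimage_def map_pmf_comp)
  then show ?thesis by (simp only: *)
qed

text \<open>
  Whether the neighbourhood of \<open>A\<close> in \<open>F\<close> equals \<open>X\<close> depends only on the pairs between \<open>A\<close> and \<open>F\<close>,
  so an event about the pairs inside \<open>W\<close>, which avoids \<open>A\<close>, is independent of it.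
\<close>

lemma exposure:
  assumes AF: "A \<inter> F = {}" "A \<union> F \<subseteq> V" and W: "A \<inter> W = {}"
    and good: "\<And>E. E \<subseteq> [V]\<^bsup>2\<^esup> \<Longrightarrow> Q E \<Longrightarrow> \<not> bad (nbr E A F) \<Longrightarrow> Y (nbr E A F) E"
    and locY: "\<And>X E. X \<subseteq> F \<Longrightarrow> E \<subseteq> [V]\<^bsup>2\<^esup> \<Longrightarrow> Y X E \<longleftrightarrow> Y X (E \<inter> Pow W)"
    and Y: "\<And>X. X \<subseteq> F \<Longrightarrow> \<not> bad X \<Longrightarrow> P (Y X) \<le> \<beta>"
    and badZ: "\<And>E. E \<subseteq> [V]\<^bsup>2\<^esup> \<Longrightarrow> Q E \<Longrightarrow> bad (nbr E A F) \<Longrightarrow> Z E"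
    and locZ: "\<And>E. E \<subseteq> [V]\<^bsup>2\<^esup> \<Longrightarrow> Z E \<longleftrightarrow> Z (E \<inter> Pow W)"
    and Z: "P Z \<le> \<beta>'" and \<beta>: "0 \<le> \<beta>"
  shows "P Q \<le> P (\<lambda>E. bad (nbr E A F)) * \<beta>' + \<beta>"
proof -
  let ?C = "{e. \<exists>a\<in>A. \<exists>f\<in>F. e = {a, f}}"
  have C: "?C \<inter> Pow W = {}" using W by auto
  have finF: "finite F" using AF finV finite_subset by auto
  \<comment> \<open>Split by the exposed neighbourhood: a bad value is charged to \<open>Z\<close>,
    and each good value \<open>X\<close> to its own event \<open>Y X\<close>.\<close>
  have "P Q \<le> P (\<lambda>E. (bad (nbr E A F) \<and> Z E) \<or> (\<exists>X\<in>Pow F. nbr E A F = X \<and> (\<not> bad X \<and> Y X E)))"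
    using good badZ by (intro P_mono) (auto simp: nbr_def)
  also have "\<dots> \<le> P (\<lambda>E. bad (nbr E A F) \<and> Z E) +
      P (\<lambda>E. \<exists>X\<in>Pow F. nbr E A F = X \<and> (\<not> bad X \<and> Y X E))"
    by (rule P_disj)
  also have "P (\<lambda>E. bad (nbr E A F) \<and> Z E) = P (\<lambda>E. bad (nbr E A F)) * P Z"
    using C by (rule P_indep) (use locZ nbr_local[of _ A F] in \<open>simp_all add: Int_assoc\<close>)
  also have "P (\<lambda>E. bad (nbr E A F)) * P Z \<le> P (\<lambda>E. bad (nbr E A F)) * \<beta>'"
    using Z by (intro mult_left_mono P_nonneg)
  also have "P (\<lambda>E. \<exists>X\<in>Pow F. nbr E A F = X \<and> (\<not> bad X \<and> Y X E)) \<le>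
      (\<Sum>X\<in>Pow F. P (\<lambda>E. nbr E A F = X \<and> (\<not> bad X \<and> Y X E)))"
  proof -
    have "{E. \<exists>X\<in>Pow F. nbr E A F = X \<and> (\<not> bad X \<and> Y X E)} =
        (\<Union>X\<in>Pow F. {E. nbr E A F = X \<and> (\<not> bad X \<and> Y X E)})" by auto
    then show ?thesis
      unfolding P_def using finF by (auto intro!: measure_pmf.finite_measure_subadditive_finite)
  qed
  also have "\<dots> \<le> (\<Sum>X\<in>Pow F. P (\<lambda>E. nbr E A F = X) * \<beta>)"
  proof (intro sum_mono)
    fix X assume X: "X \<in> Pow F"
    have "P (\<lambda>E. nbr E A F = X \<and> (\<not> bad X \<and> Y X E)) = P (\<lambda>E. nbr E A F = X) * P (\<lambda>E. \<not> bad X \<and> Y X E)"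
      using C by (rule P_indep) (use X locY nbr_local[of _ A F] in \<open>auto simp: Int_assoc\<close>)
    also have "P (\<lambda>E. \<not> bad X \<and> Y X E) \<le> \<beta>"
      using Y[of X] X \<beta> by (cases "bad X") (auto simp: P_def)
    finally show "P (\<lambda>E. nbr E A F = X \<and> (\<not> bad X \<and> Y X E)) \<le> P (\<lambda>E. nbr E A F = X) * \<beta>"
      by (simp add: mult_left_mono P_nonneg)
  qed
  also have "\<dots> = (\<Sum>X\<in>Pow F. P (\<lambda>E. nbr E A F = X)) * \<beta>"
    by (simp add: sum_distrib_right)
  \<comment> \<open>The values of the neighbourhood are disjoint events of total probability at most
    one, so \<open>\<beta>\<close> is paid once rather than once per \<open>X\<close>.\<close>
  also have "(\<Sum>X\<in>Pow F. P (\<lambda>E. nbr E A F = X)) = P (\<lambda>E. nbr E A F \<in> Pow F)"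
  proof -
    have "{E. nbr E A F \<in> Pow F} = (\<Union>X\<in>Pow F. {E. nbr E A F = X})" by auto
    then show ?thesis
      unfolding P_def using finF
      by (simp only:) (auto intro!: measure_pmf.finite_measure_finite_Union[symmetric] simp: disjoint_family_on_def)
  qed
  also have "\<dots> * \<beta> \<le> 1 * \<beta>"
    using \<beta> P_le_1 by (intro mult_right_mono)
  finally show ?thesis by simp
qed

text \<open>
  \<open>C F\<close> is the event concerning the rest of the exploration, performed in the unused vertices \<open>F\<close>.
  When a level is too small, exploring stops, but \<open>C F\<close> still contributes its factor \<open>\<beta>\<close>.
\<close>

lemma explore:
  assumes mono: "\<And>F F' E. F' \<subseteq> F \<Longrightarrow> C F E \<Longrightarrow> C F' E"
    and loc: "\<And>F E. C F E \<longleftrightarrow> C F (E \<inter> Pow (F \<union> T))"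
    and C: "\<And>F. F \<subseteq> V \<Longrightarrow> F \<inter> T = {} \<Longrightarrow> fmin \<le> card F \<Longrightarrow> P (C F) \<le> \<beta>"
    and \<beta>: "0 \<le> \<beta>" and T: "T \<subseteq> V" and \<tau>: "0 \<le> \<tau>"
    and tails: "\<And>i m. i < r \<Longrightarrow> fmin \<le> m \<Longrightarrow>
      measure_pmf.prob (binomial_pmf m (1 - (1 - p) ^ b i)) {x. x < b (Suc i)} \<le> \<tau>"
    and AF: "A \<inter> (F \<union> T) = {}" "F \<inter> T = {}" "A \<union> F \<subseteq> V" "card A = b 0"
    and cardF: "fmin + (\<Sum>i<r. b (Suc i)) \<le> card F"
  shows "P (\<lambda>E. \<not> has_path r A F T E \<and> C F E) \<le> (real r * \<tau> + (1 - p) ^ (b r * card T)) * \<beta>"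
  using tails AF cardF
proof (induction r arbitrary: A F b)
  case 0
  \<comment> \<open>With no inner vertex left, every pair between the last level and
    \<open>T\<close> must be absent; these pairs avoid the region read by
    \<open>C F\<close>.\<close>
  let ?X = "(\<lambda>(a, t). {a, t}) ` (A \<times> T)"
  have "P (\<lambda>E. \<not> has_path 0 A F T E \<and> C F E) = P (\<lambda>E. E \<inter> ?X = {} \<and> C F E)"
    by (rule arg_cong[of _ _ P]) (auto simp: fun_eq_iff)
  also have "\<dots> = P (\<lambda>E. E \<inter> ?X = {}) * P (C F)"
  proof (rule P_indep[where A = ?X and B = "Pow (F \<union> T)"])
    show "?X \<inter> Pow (F \<union> T) = {}" using 0 by auto
    show "C F E \<longleftrightarrow> C F (E \<inter> Pow (F \<union> T))" for E by (rule loc)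
  qed auto
  also have "P (\<lambda>E. E \<inter> ?X = {}) = (1 - p) ^ card ?X"
    using 0 T by (intro P_disjoint) auto
  also have "card ?X = b 0 * card T"
    using 0 by (subst card_image) (auto simp: inj_on_def doubleton_eq_iff card_cartesian_product)
  also have "P (C F) \<le> \<beta>"
    using 0 by (intro C) auto
  finally show ?case
    using p1 by (simp add: mult_left_mono)
next
  case (Suc r)
  \<comment> \<open>\<open>pick\<close> trims a large enough level to exactly the prescribed size,
    so that the size of the next set to explore from is deterministic.\<close>
  have "\<forall>X :: 'a set. \<exists>X'. X' \<subseteq> X \<and> (\<not> card X < b (Suc 0) \<longrightarrow> card X' = b (Suc 0))"
    using obtain_subset_with_card_n by (metis not_less subset_refl)
  then obtain pick :: "'a set \<Rightarrow> 'a set" where pick: "\<And>X. pick X \<subseteq> X" "\<And>X. \<not> card X < b (Suc 0) \<Longrightarrow> card (pick X) = b (Suc 0)"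
    by metis
  have finF: "finite F" using Suc.prems(4) finV finite_subset by auto
  let ?Y = "\<lambda>X E. \<not> has_path r (pick X) (F - pick X) T E \<and> C (F - pick X) E"
  have sumb: "(\<Sum>i<Suc r. b (Suc i)) = b (Suc 0) + (\<Sum>i<r. b (Suc (Suc i)))"
    by (subst sum.lessThan_Suc_shift) simp
  have "P (\<lambda>E. \<not> has_path (Suc r) A F T E \<and> C F E) \<le>
      P (\<lambda>E. card (nbr E A F) < b (Suc 0)) * \<beta> + (real r * \<tau> + (1 - p) ^ (b (Suc r) * card T)) * \<beta>"
  proof (rule exposure[where W = "F \<union> T" and Y = ?Y and Z = "C F"])
    show "A \<inter> F = {}" "A \<union> F \<subseteq> V" "A \<inter> (F \<union> T) = {}" using Suc.prems by auto
    show "?Y (nbr E A F) E" if "\<not> has_path (Suc r) A F T E \<and> C F E" for E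
      using that has_path_Suc_nbr[of r "pick (nbr E A F)" F T E A] pick(1)[of "nbr E A F"]
        mono[of "F - pick (nbr E A F)" F E] by blast
    show "?Y X E \<longleftrightarrow> ?Y X (E \<inter> Pow (F \<union> T))" if "X \<subseteq> F" for X E
    proof -
      have X: "pick X \<subseteq> F" using that pick(1)[of X] by auto
      have "has_path r (pick X) (F - pick X) T E \<longleftrightarrow> has_path r (pick X) (F - pick X) T (E \<inter> Pow (F \<union> T))"
        using X by (intro has_path_cong) auto
      moreover have "E \<inter> Pow (F \<union> T) \<inter> Pow (F - pick X \<union> T) = E \<inter> Pow (F - pick X \<union> T)" by auto
      ultimately show ?thesis
        using loc[of "F - pick X" E] loc[of "F - pick X" "E \<inter> Pow (F \<union> T)"] by simp
    qed
    show "P (?Y X) \<le> (real r * \<tau> + (1 - p) ^ (b (Suc r) * card T)) * \<beta>"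
      if X: "X \<subseteq> F" "\<not> card X < b (Suc 0)" for X
    proof (rule Suc.IH[of "\<lambda>i. b (Suc i)"])
      have "pick X \<subseteq> F" "card (pick X) = b (Suc 0)" using X pick by blast+
      then show "fmin + (\<Sum>i<r. b (Suc (Suc i))) \<le> card (F - pick X)"
        using Suc.prems(6) finF sumb by (subst card_Diff_subset) (auto intro: finite_subset)
      show "pick X \<inter> (F - pick X \<union> T) = {}" "pick X \<union> (F - pick X) \<subseteq> V"
        "card (pick X) = b (Suc 0)" "(F - pick X) \<inter> T = {}"
        using \<open>pick X \<subseteq> F\<close> \<open>card (pick X) = _\<close> Suc.prems by auto
      show "measure_pmf.prob (binomial_pmf m (1 - (1 - p) ^ b (Suc i))) {x. x < b (Suc (Suc i))} \<le> \<tau>"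
        if "i < r" "fmin \<le> m" for i m
        using Suc.prems(1)[of "Suc i" m] that by simp
    qed
    show "P (C F) \<le> \<beta>" using Suc.prems by (intro C) auto
    show "0 \<le> (real r * \<tau> + (1 - p) ^ (b (Suc r) * card T)) * \<beta>"
      using \<tau> \<beta> p1 by simp
    show "C F E \<longleftrightarrow> C F (E \<inter> Pow (F \<union> T))" for E by (rule loc)
  qed auto
  also have "P (\<lambda>E. card (nbr E A F) < b (Suc 0)) \<le> \<tau>"
  proof -
    have "P (\<lambda>E. card (nbr E A F) < b (Suc 0)) =
        measure_pmf.prob (binomial_pmf (card F) (1 - (1 - p) ^ card A)) {x. x < b (Suc 0)}"
      using Suc.prems by (intro P_card_nbr) auto
    then show ?thesis using Suc.prems(1)[of 0 "card F"] Suc.prems(5,6) by simp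
  qed
  finally show ?case
    using mult_right_mono[OF _ \<beta>] by (fastforce simp: distrib_right)
qed

text \<open>Induction over the list: explore from the first set and let \<open>C\<close> be the
  separation of the rest. The summand with \<open>length es\<close> reserves vertices for all
  explorations still to come. A set with \<open>j\<close> successors must miss their
  \<open>b 0 * j\<close> vertices from a last level of size \<open>b r\<close>.\<close>

lemma P_separated:
  assumes "distinct es" "pairwise disjnt (set es)" "\<And>e. e \<in> set es \<Longrightarrow> e \<subseteq> V \<and> card e = b 0"
    and F: "F \<subseteq> V" "F \<inter> \<Union>(set es) = {}" and \<tau>: "0 \<le> \<tau>"
    and tails: "\<And>i m. i < r \<Longrightarrow> fmin \<le> m \<Longrightarrow>
      measure_pmf.prob (binomial_pmf m (1 - (1 - p) ^ b i)) {x. x < b (Suc i)} \<le> \<tau>"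
    and cardF: "fmin + length es * (\<Sum>i<r. b (Suc i)) \<le> card F"
  shows "P (separated r es F) \<le> (\<Prod>j<length es. real r * \<tau> + (1 - p) ^ (b r * (b 0 * j)))"
  using assms(1-3) F cardF
proof (induction es arbitrary: F)
  case Nil
  then show ?case by (simp add: P_le_1)
next
  case (Cons e es)
  have dis: "e \<inter> e' = {}" if "e' \<in> set es" for e'
    using Cons.prems that by (auto simp: pairwise_def disjnt_def)
  have "card (\<Union>(set es)) = (\<Sum>e\<in>set es. card e)"
  proof (rule card_Union_disjoint)
    show "pairwise disjnt (set es)" using Cons.prems(2) by (auto simp: pairwise_insert)
    show "finite A" if "A \<in> set es" for A
      using that Cons.prems(3)[of A] finV by (auto dest: finite_subset)
  qed
  also have "\<dots> = b 0 * length es"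
    using Cons.prems(1,3) by (simp add: distinct_card)
  finally have cT: "card (\<Union>(set es)) = b 0 * length es" .
  let ?\<beta> = "\<Prod>j<length es. real r * \<tau> + (1 - p) ^ (b r * (b 0 * j))"
  have "P (\<lambda>E. \<not> has_path r e F (\<Union>(set es)) E \<and> separated r es F E) \<le>
      (real r * \<tau> + (1 - p) ^ (b r * card (\<Union>(set es)))) * ?\<beta>"
  proof (rule explore[where C = "separated r es" and fmin = "fmin + length es * (\<Sum>i<r. b (Suc i))"])
    show "separated r es F' E" if "F' \<subseteq> F" "separated r es F E" for F F' E
      using that separated_antimono by blast
    show "separated r es F E \<longleftrightarrow> separated r es F (E \<inter> Pow (F \<union> \<Union>(set es)))" for F E
      by (rule separated_local)
    show "P (separated r es F) \<le> ?\<beta>"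
      if "F \<subseteq> V" "F \<inter> \<Union>(set es) = {}" "fmin + length es * (\<Sum>i<r. b (Suc i)) \<le> card F" for F
    proof (rule Cons.IH)
      show "pairwise disjnt (set es)" using Cons.prems(2) by (auto simp: pairwise_insert)
    qed (use that Cons.prems in auto)
    show "0 \<le> ?\<beta>" using p1 \<tau> by (intro prod_nonneg) auto
    show "\<Union>(set es) \<subseteq> V" using Cons.prems by auto
    show "measure_pmf.prob (binomial_pmf m (1 - (1 - p) ^ b i)) {x. x < b (Suc i)} \<le> \<tau>"
      if "i < r" "fmin + length es * (\<Sum>i<r. b (Suc i)) \<le> m" for i m
      using that by (intro tails) auto
    show "e \<inter> (F \<union> \<Union>(set es)) = {}" using Cons.prems(5) dis by fastforce
    show "F \<inter> \<Union>(set es) = {}" "e \<union> F \<subseteq> V" "card e = b 0" using Cons.prems by auto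
    show "fmin + length es * (\<Sum>i<r. b (Suc i)) + (\<Sum>i<r. b (Suc i)) \<le> card F"
      using Cons.prems by simp
  qed (use \<tau> in auto)
  then show ?case
    by (simp add: cT mult.commute)
qed

text \<open>By \<open>separated_cong\<close>, separation does not read the pairs in
  \<open>es\<close> themselves, so their presence is independent of it.\<close>

lemma P_contains_separated:
  assumes "distinct es" "pairwise disjnt (set es)" "set es \<subseteq> [V]\<^bsup>2\<^esup>" "F \<inter> \<Union>(set es) = {}"
  shows "P (\<lambda>E. set es \<subseteq> E \<and> separated r es F E) = p ^ length es * P (separated r es F)"
proof -
  have "P (\<lambda>E. set es \<subseteq> E \<and> separated r es F E) = P (\<lambda>E. set es \<subseteq> E) * P (separated r es F)"
  proof (rule P_indep[where A = "set es" and B = "- set es"])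
    show "separated r es F E \<longleftrightarrow> separated r es F (E \<inter> - set es)" for E
    proof (rule separated_cong)
      fix a x assume "\<And>e. e \<in> set es \<Longrightarrow> a \<in> e \<Longrightarrow> x \<notin> e"
      then have "{a, x} \<notin> set es" by blast
      then show "{a, x} \<in> E \<longleftrightarrow> {a, x} \<in> E \<inter> - set es" by simp
    qed (use assms in auto)
  qed auto
  then show ?thesis
    using P_contains[OF assms(3)] assms(1) by (simp add: distinct_card)
qed

section \<open>Edges among the vertices missed by an exploration\<close>

lemma P_edge_free:
  assumes "U \<subseteq> V"
  shows "P (\<lambda>E. edge_free E U) = (1 - p) ^ (card U choose 2)"
proof -
  have fin: "finite U" using assms finV finite_subset by auto
  have "P (\<lambda>E. edge_free E U) = P (\<lambda>E. E \<inter> [U]\<^bsup>2\<^esup> = {})"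
    by (intro antisym P_mono) (auto simp: edge_free_def nsets_def)
  also have "\<dots> = (1 - p) ^ card ([U]\<^bsup>2\<^esup>)"
    using assms by (intro P_disjoint nsets_mono)
  also have "[U]\<^bsup>2\<^esup> = {B. B \<subseteq> U \<and> card B = 2}"
    using fin by (auto simp: nsets_def intro: finite_subset)
  finally show ?thesis using fin by (simp add: n_subsets)
qed

text \<open>The round reads only the pairs between \<open>A\<close> and \<open>F\<close>, so the
  pairs among the vertices it misses are still unexposed. The threshold \<open>u\<close> separates
  two cases: few missed vertices, or many of them spanning no edge.\<close>

lemma P_edge_free_unreached_one:
  assumes AF: "A \<inter> F = {}" "A \<union> F \<subseteq> V"
  shows "P (\<lambda>E. edge_free E (unreached 1 A F E)) \<le>
    P (\<lambda>E. card F - card (nbr E A F) < u) + (1 - p) ^ (u choose 2)"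
proof -
  have fin: "finite F" using AF finV finite_subset by auto
  have "P (\<lambda>E. edge_free E (unreached 1 A F E)) \<le>
      P (\<lambda>E. card F - card (nbr E A F) < u) * 1 + (1 - p) ^ (u choose 2)"
  proof (rule exposure[where W = F and Y = "\<lambda>X E. edge_free E (F - X)" and Z = "\<lambda>_. True"
        and bad = "\<lambda>X. card F - card X < u"])
    show "edge_free E (F - X) \<longleftrightarrow> edge_free (E \<inter> Pow F) (F - X)" for X E
      by (auto simp: edge_free_def)
    show "P (\<lambda>E. edge_free E (F - X)) \<le> (1 - p) ^ (u choose 2)"
      if X: "X \<subseteq> F" "\<not> card F - card X < u" for X
    proof -
      have "u \<le> card (F - X)" using X fin by (simp add: card_Diff_subset finite_subset)
      then have "u choose 2 \<le> card (F - X) choose 2" by (rule binomial_right_mono)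
      then show ?thesis
        using AF p0 p1 by (subst P_edge_free) (auto intro: power_decreasing)
    qed
  qed (use AF p1 P_le_1 in auto)
  then show ?thesis by simp
qed

text \<open>In contrast to \<open>explore\<close>, levels are capped from above by \<open>a\<close>;
  each of the first \<open>r\<close> rounds exceeds its cap with probability at most
  \<open>\<tau>\<close>. The sum subtracted from \<open>fmin\<close> bounds the vertices used up
  before the final round, which the assumption \<open>last\<close> handles.\<close>

lemma P_edge_free_unreached:
  fixes a :: "nat \<Rightarrow> real"
  assumes last: "\<And>A F. A \<inter> F = {} \<Longrightarrow> A \<union> F \<subseteq> V \<Longrightarrow> real (card A) \<le> a r \<Longrightarrow>
      fmin - (\<Sum>i<r. a (Suc i)) \<le> real (card F) \<Longrightarrow> P (\<lambda>E. edge_free E (unreached 1 A F E)) \<le> \<sigma>"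
    and tails: "\<And>i A F. i < r \<Longrightarrow> A \<inter> F = {} \<Longrightarrow> A \<union> F \<subseteq> V \<Longrightarrow> real (card A) \<le> a i \<Longrightarrow>
      P (\<lambda>E. real (card (nbr E A F)) > a (Suc i)) \<le> \<tau>"
    and \<tau>: "0 \<le> \<tau>" and \<sigma>: "0 \<le> \<sigma>"
    and AF: "A \<inter> F = {}" "A \<union> F \<subseteq> V" "real (card A) \<le> a 0" "fmin \<le> real (card F)"
  shows "P (\<lambda>E. edge_free E (unreached (Suc r) A F E)) \<le> real r * \<tau> + \<sigma>"
  using last tails AF
proof (induction r arbitrary: a A F fmin)
  case 0
  then show ?case by simp
next
  case (Suc r)
  have fin: "finite F" using Suc.prems finV finite_subset by auto
  have sum: "(\<Sum>i<Suc r. a (Suc i)) = a (Suc 0) + (\<Sum>i<r. a (Suc (Suc i)))"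
    by (subst sum.lessThan_Suc_shift) simp
  have "P (\<lambda>E. edge_free E (unreached (Suc (Suc r)) A F E)) \<le>
      P (\<lambda>E. real (card (nbr E A F)) > a (Suc 0)) * 1 + (real r * \<tau> + \<sigma>)"
  proof (rule exposure[where W = F and Y = "\<lambda>X E. edge_free E (unreached (Suc r) X (F - X) E)"
        and Z = "\<lambda>_. True" and bad = "\<lambda>X. real (card X) > a (Suc 0)"])
    show "edge_free E (unreached (Suc r) X (F - X) E) \<longleftrightarrow>
        edge_free (E \<inter> Pow F) (unreached (Suc r) X (F - X) (E \<inter> Pow F))" if "X \<subseteq> F" for X E
    proof -
      have "unreached (Suc r) X (F - X) (E \<inter> Pow F) = unreached (Suc r) X (F - X) E"
        using that by (intro unreached_local[symmetric]) auto
      moreover have "unreached (Suc r) X (F - X) E \<subseteq> F"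
        using unreached_subset[of "Suc r" X "F - X" E] by blast
      note edge_free_local[OF this, of E]
      ultimately show ?thesis by (simp only:)
    qed
    show "P (\<lambda>E. edge_free E (unreached (Suc r) X (F - X) E)) \<le> real r * \<tau> + \<sigma>"
      if X: "X \<subseteq> F" "\<not> a (Suc 0) < real (card X)" for X
    proof (rule Suc.IH[of "\<lambda>i. a (Suc i)" "fmin - a (Suc 0)"])
      show "fmin - a (Suc 0) \<le> real (card (F - X))"
        using X Suc.prems(6) fin by (simp add: card_Diff_subset finite_subset of_nat_diff card_mono)
      show "P (\<lambda>E. edge_free E (unreached 1 A F E)) \<le> \<sigma>"
        if "A \<inter> F = {}" "A \<union> F \<subseteq> V" "real (card A) \<le> a (Suc r)"
          "fmin - a (Suc 0) - (\<Sum>i<r. a (Suc (Suc i))) \<le> real (card F)" for A F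
        using that sum by (intro Suc.prems(1)) auto
      show "P (\<lambda>E. a (Suc (Suc i)) < real (card (nbr E A F))) \<le> \<tau>"
        if "i < r" "A \<inter> F = {}" "A \<union> F \<subseteq> V" "real (card A) \<le> a (Suc i)" for i A F
        using that by (intro Suc.prems(2)) auto
    qed (use X Suc.prems in auto)
  qed (use Suc.prems \<tau> \<sigma> P_le_1 in auto)
  moreover have "P (\<lambda>E. real (card (nbr E A F)) > a (Suc 0)) \<le> \<tau>"
    using Suc.prems by (intro Suc.prems(2)) auto
  ultimately show ?case by (simp add: algebra_simps)
qed

end

subsection \<open>Large matchings\<close>

lemma power_div_fact_le_exp:
  fixes x :: real
  assumes "0 \<le> x"
  shows "x ^ m / fact m \<le> exp x"
proof -
  have "(\<Sum>k\<in>{m}. x ^ k /\<^sub>R fact k) \<le> (\<Sum>k. x ^ k /\<^sub>R fact k)"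
    using assms by (intro sum_le_suminf summable_exp_generic) auto
  then show ?thesis by (simp add: exp_def divide_inverse mult.commute)
qed

lemma binomial_le_exp_pow:
  assumes "0 < m"
  shows "real (a choose m) \<le> (exp 1 * real a / real m) ^ m"
proof -
  have "real (a choose m) * fact m \<le> real a ^ m"
    using binomial_fact_pow[of a m] by (metis of_nat_fact of_nat_le_iff of_nat_mult of_nat_power)
  then have "real (a choose m) \<le> real a ^ m / fact m"
    by (simp add: field_simps)
  also have "real m ^ m / fact m \<le> exp (real m)"
    by (rule power_div_fact_le_exp) simp
  then have "1 / fact m \<le> exp (real m) / real m ^ m"
    using assms by (simp add: field_simps)
  then have "real a ^ m * (1 / fact m) \<le> real a ^ m * (exp (real m) / real m ^ m)"
    by (intro mult_left_mono) auto
  then have "real a ^ m / fact m \<le> real a ^ m * (exp (real m) / real m ^ m)"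
    by simp
  also have "\<dots> = (exp 1 * real a / real m) ^ m"
    by (simp add: power_mult_distrib power_divide exp_of_nat_mult[symmetric])
  finally show ?thesis .
qed

lemma one_minus_power_le_exp:
  fixes p :: real
  assumes "p \<le> 1"
  shows "(1 - p) ^ a \<le> exp (- (p * real a))"
proof -
  have "(1 - p) ^ a \<le> exp (- p) ^ a"
    using assms exp_ge_add_one_self[of "- p"] by (intro power_mono) auto
  also have "\<dots> = exp (- (p * real a))"
    by (simp add: exp_of_nat_mult[symmetric] mult.commute)
  finally show ?thesis .
qed

text \<open>For \<open>p * a \<le> \<delta>\<close> the hitting probability is at least
  \<open>(1 - \<delta>) * p * a\<close>. The factor \<open>1 - 4 * \<delta>\<close> absorbs three
  losses: \<open>1 - 2 * \<delta>\<close> for used vertices, \<open>1 - \<delta>\<close> for this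
  approximation and \<open>1 - \<delta>\<close> for the deviation.\<close>

lemma binomial_nbr_lower_tail:
  fixes p \<delta> n :: real
  assumes p: "0 \<le> p" "p \<le> 1" and \<delta>: "0 \<le> \<delta>" "\<delta> \<le> 1 / 4" and a: "p * real a \<le> \<delta>"
    and n: "0 \<le> n" "(1 - 2 * \<delta>) * n \<le> real m"
  shows "measure_pmf.prob (binomial_pmf m (1 - (1 - p) ^ a)) {x. real x < (1 - 4 * \<delta>) * (n * p) * real a}
    \<le> exp (- \<delta>\<^sup>2 * ((1 - 2 * \<delta>) * (1 - \<delta>) * (n * p) * real a) / 4)"
proof -
  define \<mu> where "\<mu> = (1 - 2 * \<delta>) * (1 - \<delta>) * (n * p) * real a"
  have q: "0 \<le> 1 - (1 - p) ^ a" "1 - (1 - p) ^ a \<le> 1"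
    using p by (auto simp: power_le_one)
  have pa: "0 \<le> p * real a" using p by simp
  have "(1 - p) ^ a \<le> 1 - p * real a + (p * real a)\<^sup>2"
    using one_minus_power_le_exp[OF p(2), of a] exp_minus_le_quadratic[OF pa] by linarith
  moreover have "(p * real a)\<^sup>2 \<le> p * real a * \<delta>"
    using a pa by (simp add: power2_eq_square mult_left_mono)
  ultimately have ql: "(1 - \<delta>) * (p * real a) \<le> 1 - (1 - p) ^ a"
    by (simp add: algebra_simps)
  have "\<mu> = ((1 - 2 * \<delta>) * n) * ((1 - \<delta>) * (p * real a))"
    by (simp add: \<mu>_def)
  also have "\<dots> \<le> real m * (1 - (1 - p) ^ a)"
    using ql n \<delta> pa by (intro mult_mono) auto
  finally have \<mu>: "\<mu> \<le> real m * (1 - (1 - p) ^ a)" .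
  have \<mu>0: "0 \<le> \<mu>" using p \<delta> n by (auto simp: \<mu>_def)
  have "1 - 4 * \<delta> \<le> (1 - \<delta>) * ((1 - 2 * \<delta>) * (1 - \<delta>))"
  proof -
    have "(1 - \<delta>) * ((1 - 2 * \<delta>) * (1 - \<delta>)) - (1 - 4 * \<delta>) = \<delta>\<^sup>2 * (5 - 2 * \<delta>)"
      by (simp add: algebra_simps power2_eq_square)
    moreover have "0 \<le> \<delta>\<^sup>2 * (5 - 2 * \<delta>)" using \<delta> by simp
    ultimately show ?thesis by linarith
  qed
  then have "(1 - 4 * \<delta>) * ((n * p) * real a) \<le> (1 - \<delta>) * ((1 - 2 * \<delta>) * (1 - \<delta>)) * ((n * p) * real a)"
    using p n by (intro mult_right_mono) auto
  then have "(1 - 4 * \<delta>) * (n * p) * real a \<le> (1 - \<delta>) * \<mu>"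
    by (simp add: \<mu>_def mult.assoc)
  then have "measure_pmf.prob (binomial_pmf m (1 - (1 - p) ^ a)) {x. real x < (1 - 4 * \<delta>) * (n * p) * real a}
    \<le> measure_pmf.prob (binomial_pmf m (1 - (1 - p) ^ a)) {x. real x < (1 - \<delta>) * \<mu>}"
    by (intro measure_pmf.finite_measure_mono) auto
  also have "\<dots> \<le> exp (- \<delta>\<^sup>2 * \<mu> / 4)"
    using \<delta> by (intro binomial_lower_tail q \<mu> \<mu>0) auto
  finally show ?thesis by (simp add: \<mu>_def)
qed

text \<open>The prescribed sizes of the levels of an exploration from the two ends of an edge.\<close>

lemma ceil_growth:
  fixes \<gamma> d :: real
  assumes \<gamma>: "1 / 2 \<le> \<gamma>" and d: "1 \<le> (1 - \<gamma>) * d" "2 \<le> d"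
  defines "b \<equiv> rec_nat 2 (\<lambda>_ a. nat \<lceil>\<gamma> * d * real a\<rceil>)"
  shows "2 * (\<gamma> * d) ^ i \<le> real (b i)" "real (b i) \<le> 2 * d ^ i" "2 \<le> b i"
    "b (Suc i) = nat \<lceil>\<gamma> * d * real (b i)\<rceil>"
proof -
  have Suc: "b (Suc i) = nat \<lceil>\<gamma> * d * real (b i)\<rceil>" for i
    by (simp add: b_def)
  then show "b (Suc i) = nat \<lceil>\<gamma> * d * real (b i)\<rceil>" .
  have \<gamma>d: "1 \<le> \<gamma> * d"
    using \<gamma> d(2) mult_mono[of "1/2" \<gamma> 2 d] by simp
  have "2 * (\<gamma> * d) ^ i \<le> real (b i) \<and> real (b i) \<le> 2 * d ^ i \<and> 2 \<le> b i"
  proof (induction i)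
    case 0
    then show ?case by (simp add: b_def)
  next
    case (Suc i)
    have up: "real (b (Suc i)) \<le> \<gamma> * d * real (b i) + 1"
      unfolding \<open>b (Suc i) = _\<close> Suc using \<gamma>d of_nat_0_le_iff[of "b i"]
      by (smt (verit) of_int_ceiling_le_add_one mult_nonneg_nonneg of_nat_nat zero_le_ceiling)
    have lo: "\<gamma> * d * real (b i) \<le> real (b (Suc i))"
      unfolding \<open>b (Suc i) = _\<close> by (rule real_nat_ceiling_ge)
    \<comment> \<open>The slack \<open>(1 - \<gamma>) * d \<ge> 1\<close> absorbs the rounding up,
      so a level grows by at most a factor \<open>d\<close>.\<close>
    have "1 * 1 \<le> (1 - \<gamma>) * d * real (b i)"
      using Suc.IH d(1) by (intro mult_mono) auto
    then have "real (b (Suc i)) \<le> d * real (b i)"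
      using up by (simp add: algebra_simps)
    also have "\<dots> \<le> d * (2 * d ^ i)" using Suc.IH d by (intro mult_left_mono) auto
    finally have 1: "real (b (Suc i)) \<le> 2 * d ^ Suc i" by (simp add: algebra_simps)
    have "\<gamma> * d * (2 * (\<gamma> * d) ^ i) \<le> \<gamma> * d * real (b i)"
      using Suc.IH \<gamma>d by (intro mult_left_mono) auto
    then have 2: "2 * (\<gamma> * d) ^ Suc i \<le> real (b (Suc i))"
      using lo by (simp add: algebra_simps)
    have "1 * real 2 \<le> \<gamma> * d * real (b i)"
      using Suc.IH \<gamma>d by (intro mult_mono) auto
    then have "2 \<le> b (Suc i)" using lo by linarith
    with 1 2 show ?case by blast
  qed
  then show "2 * (\<gamma> * d) ^ i \<le> real (b i)" "real (b i) \<le> 2 * d ^ i" "2 \<le> b i"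
    by blast+
qed

context gnp
begin

text \<open>A union bound over all families of \<open>m\<close> pairs, each listed in some fixed
  order. The presence of the pairs contributes \<open>p ^ m\<close> and their separation the factor
  \<open>\<beta>\<close>.\<close>

lemma P_k_matching:
  assumes k: "k \<ge> 2" and \<beta>: "0 \<le> \<beta>"
    and sep: "\<And>es. distinct es \<Longrightarrow> pairwise disjnt (set es) \<Longrightarrow> set es \<subseteq> [V]\<^bsup>2\<^esup> \<Longrightarrow> length es = m \<Longrightarrow>
      P (separated (k - 2) es (V - \<Union>(set es))) \<le> \<beta>"
  shows "P (\<lambda>E. \<exists>M. k_matching k E M \<and> m \<le> card M) \<le> real ((card V choose 2) choose m) * (p ^ m * \<beta>)"
proof -
  define \<M> where "\<M> = {M. M \<subseteq> [V]\<^bsup>2\<^esup> \<and> card M = m}"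
  have "\<exists>es. set es = M \<and> distinct es" if "M \<in> \<M>" for M
    using that fin_pairs by (intro finite_distinct_list) (auto simp: \<M>_def intro: finite_subset)
  then obtain es where es: "\<And>M. M \<in> \<M> \<Longrightarrow> set (es M) = M \<and> distinct (es M)"
    by metis
  define Q where "Q M E \<longleftrightarrow> pairwise disjnt M \<and> M \<subseteq> E \<and> separated (k - 2) (es M) (V - \<Union>M) E" for M E
  have "P (\<lambda>E. \<exists>M. k_matching k E M \<and> m \<le> card M) \<le> P (\<lambda>E. \<exists>M\<in>\<M>. Q M E)"
  proof (rule P_mono)
    fix E assume E: "E \<subseteq> [V]\<^bsup>2\<^esup>" and "\<exists>M. k_matching k E M \<and> m \<le> card M"
    then obtain M where M: "k_matching k E M" "m \<le> card M" by blast
    \<comment> \<open>Separation passes to subfamilies of a \<open>k\<close>-matching, so exactly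
      \<open>m\<close> of its edges may be extracted.\<close>
    obtain M' where M': "M' \<subseteq> M" "card M' = m"
      using M(2) obtain_subset_with_card_n by metis
    have ME: "M \<subseteq> E" using M(1) by (simp add: k_matching_def)
    then have in\<M>: "M' \<in> \<M>" using M' E by (auto simp: \<M>_def)
    have "pairwise disjnt M'"
    proof (rule pairwiseI)
      fix e f assume "e \<in> M'" "f \<in> M'" "e \<noteq> f"
      then show "disjnt e f"
        using M(1) M'(1) unfolding k_matching_def disjnt_iff by blast
    qed
    moreover have "separated (k - 2) (es M') (V - \<Union>M') E"
      using es[OF in\<M>] M' by (intro k_matching_separated[OF k M(1)]) auto
    ultimately show "\<exists>M\<in>\<M>. Q M E"
      using in\<M> M' ME by (auto simp: Q_def)
  qed
  also have "\<dots> \<le> real (card \<M>) * (p ^ m * \<beta>)"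
  proof (rule P_union_bound)
    show "finite \<M>" using fin_pairs by (auto simp: \<M>_def)
    fix M assume M: "M \<in> \<M>"
    have len: "length (es M) = m" using es[OF M] M by (metis (mono_tags, lifting) \<M>_def distinct_card mem_Collect_eq)
    show "P (Q M) \<le> p ^ m * \<beta>"
    proof (cases "pairwise disjnt M")
      case True
      then have "P (Q M) = P (\<lambda>E. set (es M) \<subseteq> E \<and> separated (k - 2) (es M) (V - \<Union>(set (es M))) E)"
        using es[OF M] by (simp add: Q_def[abs_def])
      also have "\<dots> = p ^ length (es M) * P (separated (k - 2) (es M) (V - \<Union>(set (es M))))"
        using es[OF M] True M by (intro P_contains_separated) (auto simp: \<M>_def)
      also have "\<dots> \<le> p ^ m * \<beta>"
        unfolding len using es[OF M] True M p0 len
        by (intro mult_left_mono sep) (auto simp: \<M>_def)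
      finally show ?thesis .
    next
      case False
      then show ?thesis using p0 \<beta> by (simp add: Q_def[abs_def] P_def)
    qed
  qed
  also have "card \<M> = (card V choose 2) choose m"
  proof -
    have "[V]\<^bsup>2\<^esup> = {B. B \<subseteq> V \<and> card B = 2}"
      using finV by (auto simp: nsets_def intro: finite_subset)
    then show ?thesis
      unfolding \<M>_def using fin_pairs finV by (simp add: n_subsets)
  qed
  finally show ?thesis .
qed

text \<open>The expected number of choices of \<open>m\<close> present edges is at most
  \<open>exp (k * ln d) ^ m\<close>, while separation contributes about
  \<open>exp (- (1 + \<epsilon> / 2) * k * ln d) ^ m\<close>. \<open>d1\<close> absorbs the rounding
  of level sizes, \<open>d2\<close> keeps the used vertices to a small part of \<open>n\<close>,
  \<open>d3\<close> makes failed levels negligible against the main term, \<open>d4\<close> beats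
  constant factors, and \<open>N1\<close> gives \<open>p * b i \<le> \<delta>\<close>.\<close>

lemma matching_upper_bound:
  fixes k :: nat and \<epsilon> \<delta> d N :: real
  assumes k: "k \<ge> 2" and \<epsilon>: "0 < \<epsilon>" "\<epsilon> \<le> 1 / 2" and \<delta>: "\<delta> = \<epsilon> / (16 * real k)"
    and d: "d = real (card V) * p" and N: "N = real (card V) / d ^ (k - 1)"
    and d1: "1 \<le> 4 * \<delta> * d" and d2: "2 * (real k)\<^sup>2 * ln d \<le> \<delta> * d"
    and d3: "real k * exp (- \<delta>\<^sup>2 * d / 4) \<le> exp (- 4 * real k * ln d)"
    and d4: "6 / \<epsilon> \<le> ln d" and N1: "2 / \<delta> \<le> N"
  shows "P (\<lambda>E. \<exists>M. k_matching k E M \<and> (1 + \<epsilon>) * (real k * N * ln d / 2) < real (card M)) \<le> exp (- N / 2)"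
proof -
  define n where "n = real (card V)"
  define R where "R = k - 2"
  define \<gamma> where "\<gamma> = 1 - 4 * \<delta>"
  define b where "b = rec_nat 2 (\<lambda>_ a. nat \<lceil>\<gamma> * d * real a\<rceil>)"
  define w where "w = (\<Sum>i<R. b (Suc i))"
  define m where "m = nat \<lceil>(1 + \<epsilon>) * (real k * N * ln d / 2)\<rceil>"
  define \<tau> where "\<tau> = exp (- \<delta>\<^sup>2 * d / 4)"
  \<comment> \<open>As \<open>p * d ^ R = 1 / N\<close>, the product \<open>y * j\<close> is the
    expected number of edges between \<open>2 * (\<gamma> * d) ^ R\<close> vertices of a last level
    and the \<open>2 * j\<close> vertices of later pairs.\<close>
  define y where "y = 4 * \<gamma> ^ R / N"
  have kR: "k = R + 2" "k - 1 = Suc R" using k by (auto simp: R_def)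
  have \<delta>0: "0 < \<delta>" using \<epsilon> k by (simp add: \<delta>)
  have \<delta>k: "16 * real k * \<delta> = \<epsilon>" using k by (simp add: \<delta>)
  have "16 * 2 * \<delta> \<le> 16 * real k * \<delta>" using k \<delta>0 by (intro mult_right_mono) auto
  then have \<delta>1: "\<delta> \<le> 1 / 64" using \<delta>k \<epsilon> by linarith
  have \<gamma>: "1 / 2 \<le> \<gamma>" "\<gamma> \<le> 1" using \<delta>1 \<delta>0 by (auto simp: \<gamma>_def)
  have d16: "16 \<le> d"
  proof (rule ccontr)
    assume "\<not> 16 \<le> d"
    moreover have "0 < d"
    proof (rule ccontr)
      assume "\<not> 0 < d"
      then have "4 * \<delta> * d \<le> 0" using \<delta>0 by (intro mult_nonneg_nonpos) auto
      then show False using d1 by simp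
    qed
    ultimately have "4 * \<delta> * d < (4 * (1 / 64)) * 16"
      using \<delta>1 \<delta>0 by (intro mult_le_less_imp_less) auto
    then show False using d1 by simp
  qed
  have lnd: "12 \<le> ln d"
  proof -
    have "12 \<le> 6 / \<epsilon>" using \<epsilon> by (simp add: field_simps)
    then show ?thesis using d4 by linarith
  qed
  have n0: "0 < n" using d d16 n_def by (cases "card V = 0") auto
  have dn: "d = n * p" by (simp add: d n_def)
  have N0: "0 < N" using n0 d16 by (simp add: N n_def)
  have N128: "128 \<le> N"
  proof -
    have "128 \<le> 2 / \<delta>" using \<delta>1 \<delta>0 by (simp add: field_simps)
    then show ?thesis using N1 by linarith
  qed
  have Nn: "N * d ^ Suc R = n" using d16 by (simp add: N n_def kR)
  have pd: "p * d ^ R * N = 1"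
  proof -
    have "p * d ^ R * N * n = d ^ R * N * d" by (simp add: dn)
    also have "\<dots> = n" using Nn by (simp add: algebra_simps)
    finally show ?thesis using n0 by simp
  qed
  have kNd: "12 \<le> ln d" "1 \<le> real k * N * ln d / 4" "N \<le> real k * N * ln d / 2"
  proof -
    have "2 * N * 12 \<le> real k * N * ln d" using k N0 lnd by (intro mult_mono) auto
    then show "1 \<le> real k * N * ln d / 4" "N \<le> real k * N * ln d / 2" using N128 by linarith+
  qed (rule lnd)
  have m_lo: "(1 + \<epsilon>) * (real k * N * ln d / 2) \<le> real m"
    unfolding m_def by (rule real_nat_ceiling_ge)
  have x_ge: "real k * N * ln d / 2 \<le> (1 + \<epsilon>) * (real k * N * ln d / 2)"
    using mult_right_mono[of 1 "1 + \<epsilon>" "real k * N * ln d / 2"] \<epsilon> kNd N0 by simp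
  have mN: "N \<le> real m" using m_lo x_ge kNd by linarith
  have m0: "0 < m" using mN N0 by linarith
  have m_hi: "real m \<le> real k * N * ln d"
  proof -
    have "real m \<le> (1 + \<epsilon>) * (real k * N * ln d / 2) + 1"
    proof -
      have "0 \<le> (1 + \<epsilon>) * (real k * N * ln d / 2)" using x_ge kNd N0 by linarith
      then show ?thesis
        unfolding m_def using of_int_ceiling_le_add_one by (simp add: zero_le_ceiling)
    qed
    moreover have "(1 + \<epsilon>) * (real k * N * ln d / 2) \<le> 3 / 2 * (real k * N * ln d / 2)"
      using \<epsilon> kNd N0 by (intro mult_right_mono) linarith+
    ultimately show ?thesis using kNd(2) by linarith
  qed
  have b: "2 * (\<gamma> * d) ^ i \<le> real (b i)" "real (b i) \<le> 2 * d ^ i" "2 \<le> b i"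
    "b (Suc i) = nat \<lceil>\<gamma> * d * real (b i)\<rceil>" for i
    unfolding b_def using \<gamma> d1 d16 by (auto intro!: ceil_growth simp: \<gamma>_def)
  have b0: "b 0 = 2" by (simp add: b_def)
  have w: "real w \<le> real R * (2 * d ^ R)"
  proof -
    have "real w = (\<Sum>i<R. real (b (Suc i)))" by (simp add: w_def)
    also have "\<dots> \<le> (\<Sum>i<R. 2 * d ^ R)"
    proof (intro sum_mono)
      fix i assume "i \<in> {..<R}"
      then have "d ^ Suc i \<le> d ^ R" using d16 by (intro power_increasing) auto
      then show "real (b (Suc i)) \<le> 2 * d ^ R" using b(2)[of "Suc i"] by linarith
    qed
    finally show ?thesis by simp
  qed
  \<comment> \<open>One exploration uses \<open>w\<close> vertices besides its pair, so this bounds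
    the total over all \<open>m\<close> pairs.\<close>
  have used: "2 * real m + real m * real w \<le> 2 * \<delta> * n"
  proof -
    have "2 + real w \<le> 2 * real k * d ^ R"
    proof -
      have "1 \<le> d ^ R" using d16 by (intro one_le_power) auto
      then have "2 + real w \<le> 2 * d ^ R + real R * (2 * d ^ R)" using w by linarith
      also have "\<dots> = (2 * real R + 2) * d ^ R" by (simp add: algebra_simps)
      also have "\<dots> \<le> 2 * real k * d ^ R" using d16 by (intro mult_right_mono) (auto simp: kR)
      finally show ?thesis .
    qed
    then have "real m * (2 + real w) \<le> (real k * N * ln d) * (2 * real k * d ^ R)"
      using m_hi by (intro mult_mono) auto
    also have "\<dots> = N * d ^ R * (2 * (real k)\<^sup>2 * ln d)" by (simp add: power2_eq_square)
    also have "\<dots> \<le> N * d ^ R * (\<delta> * d)" using d2 N0 d16 by (intro mult_left_mono) auto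
    also have "\<dots> = \<delta> * n" using Nn by (simp add: algebra_simps)
    also have "\<dots> \<le> 2 * \<delta> * n" using \<delta>0 n0 by simp
    finally show ?thesis by (simp add: algebra_simps)
  qed
  have used_nat: "2 * m + m * w \<le> card V"
  proof -
    have "2 * \<delta> * n \<le> 1 * n" using \<delta>1 n0 by (intro mult_right_mono) auto
    then have "real (2 * m + m * w) \<le> real (card V)" using used by (simp add: n_def)
    then show ?thesis by (simp only: of_nat_le_iff)
  qed
  define fmin where "fmin = card V - (2 * m + m * w)"
  have fmin: "(1 - 2 * \<delta>) * n \<le> real fmin"
    unfolding fmin_def using used used_nat by (simp add: of_nat_diff n_def algebra_simps)
  let ?B = "\<Prod>j<m. real R * \<tau> + (1 - p) ^ (b R * (b 0 * j))"
  have sep: "P (separated (k - 2) es (V - \<Union>(set es))) \<le> ?B"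
    if es: "distinct es" "pairwise disjnt (set es)" "set es \<subseteq> [V]\<^bsup>2\<^esup>" "length es = m" for es
  proof -
    have "P (separated R es (V - \<Union>(set es))) \<le> (\<Prod>j<length es. real R * \<tau> + (1 - p) ^ (b R * (b 0 * j)))"
    proof (rule P_separated[where fmin = fmin])
      show e: "e \<subseteq> V \<and> card e = b 0" if "e \<in> set es" for e
        using that es(3) by (auto simp: nsets_def b0)
      have "card (\<Union>(set es)) = (\<Sum>e\<in>set es. card e)"
        using es e finV by (intro card_Union_disjoint) (auto dest: finite_subset)
      also have "\<dots> = 2 * m"
        using es e by (simp add: distinct_card b0)
      finally have "card (V - \<Union>(set es)) = card V - 2 * m"
        using e finV by (subst card_Diff_subset) (auto intro: finite_subset[OF _ finV])
      then show "fmin + length es * (\<Sum>i<R. b (Suc i)) \<le> card (V - \<Union>(set es))"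
        using used_nat es(4) by (simp add: fmin_def w_def)
      show "measure_pmf.prob (binomial_pmf f (1 - (1 - p) ^ b i)) {x. x < b (Suc i)} \<le> \<tau>"
        if i: "i < R" and f: "fmin \<le> f" for i f
      proof -
        \<comment> \<open>A natural number lies below the ceiling of a nonnegative real exactly when
          it lies below that real, so the rounding in \<open>b\<close> costs nothing here.\<close>
        have "{x. x < b (Suc i)} \<subseteq> {x. real x < (1 - 4 * \<delta>) * (n * p) * real (b i)}"
          unfolding b(4) by (auto simp: \<gamma>_def dn[symmetric] less_ceiling_iff nat_less_eq_zless zless_nat_eq_int_zless)
        then have "measure_pmf.prob (binomial_pmf f (1 - (1 - p) ^ b i)) {x. x < b (Suc i)} \<le>
            measure_pmf.prob (binomial_pmf f (1 - (1 - p) ^ b i)) {x. real x < (1 - 4 * \<delta>) * (n * p) * real (b i)}"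
          by (intro measure_pmf.finite_measure_mono) auto
        also have "\<dots> \<le> exp (- \<delta>\<^sup>2 * ((1 - 2 * \<delta>) * (1 - \<delta>) * (n * p) * real (b i)) / 4)"
        proof (rule binomial_nbr_lower_tail)
          have "p * real (b i) \<le> p * (2 * d ^ R)"
          proof (intro mult_left_mono p0)
            have "d ^ i \<le> d ^ R" using i d16 by (intro power_increasing) auto
            then show "real (b i) \<le> 2 * d ^ R" using b(2)[of i] by linarith
          qed
          also have "\<dots> = 2 / N" using pd N0 by (simp add: field_simps)
          also have "\<dots> \<le> \<delta>" using N1 \<delta>0 N0 by (simp add: field_simps)
          finally show "p * real (b i) \<le> \<delta>" .
          show "(1 - 2 * \<delta>) * n \<le> real f" using fmin f by linarith
        qed (use p0 p1 \<delta>0 \<delta>1 n0 in auto)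
        also have "\<dots> \<le> \<tau>"
        proof -
          have "1 * d \<le> ((1 - 2 * \<delta>) * (1 - \<delta>) * real (b i)) * d"
          proof (intro mult_right_mono)
            have "(1 - 2 * \<delta>) * (1 - \<delta>) = 1 - 3 * \<delta> + 2 * (\<delta> * \<delta>)"
              by (simp add: algebra_simps)
            moreover have "0 \<le> \<delta> * \<delta>" by simp
            ultimately have "1 / 2 \<le> (1 - 2 * \<delta>) * (1 - \<delta>)"
              using \<delta>1 by linarith
            then have "(1 / 2) * 2 \<le> (1 - 2 * \<delta>) * (1 - \<delta>) * real (b i)"
              using b(3)[of i] by (intro mult_mono) auto
            then show "1 \<le> (1 - 2 * \<delta>) * (1 - \<delta>) * real (b i)" by simp
          qed (use d16 in auto)
          then have "\<delta>\<^sup>2 * d \<le> \<delta>\<^sup>2 * ((1 - 2 * \<delta>) * (1 - \<delta>) * (n * p) * real (b i))"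
            unfolding dn[symmetric] by (intro mult_left_mono) (auto simp: algebra_simps)
          then show ?thesis by (simp add: \<tau>_def)
        qed
        finally show ?thesis .
      qed
    qed (use es in \<open>auto simp: \<tau>_def\<close>)
    then show ?thesis using es(4) by (simp add: R_def)
  qed
  have fac: "real R * \<tau> + (1 - p) ^ (b R * (b 0 * j)) \<le> 2 * exp (- y * real j)" if j: "j < m" for j
  proof -
    \<comment> \<open>The exponent never exceeds \<open>4 * k * ln d\<close>, so by
      \<open>d3\<close> the failure term is dominated by the main term and costs only a factor of
      two.\<close>
    have y1: "y * real j \<le> 4 * real k * ln d"
    proof -
      have "\<gamma> ^ R \<le> 1" using \<gamma> by (intro power_le_one) auto
      then have "y \<le> 4 / N" using N0 by (simp add: y_def divide_right_mono)
      then have "y * real j \<le> 4 / N * (real k * N * ln d)"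
        using j m_hi N0 by (intro mult_mono) auto
      then show ?thesis using N0 by simp
    qed
    have "real R * \<tau> \<le> real k * \<tau>" by (intro mult_right_mono) (auto simp: R_def \<tau>_def)
    also have "\<dots> \<le> exp (- y * real j)" using d3 y1 unfolding \<tau>_def by (smt (verit) exp_le_cancel_iff mult_minus_left)
    finally have 1: "real R * \<tau> \<le> exp (- y * real j)" .
    have "y * real j = p * d ^ R * N * (4 * \<gamma> ^ R / N) * real j" using pd by (simp add: y_def)
    also have "\<dots> = p * (2 * (\<gamma> * d) ^ R * (2 * real j))"
      using N0 by (simp add: power_mult_distrib)
    also have "\<dots> \<le> p * (real (b R) * (2 * real j))"
      using b(1)[of R] p0 by (intro mult_left_mono mult_right_mono) auto
    finally have "exp (- (p * real (b R * (b 0 * j)))) \<le> exp (- y * real j)" by (simp add: b0)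
    with one_minus_power_le_exp[OF p1, of "b R * (b 0 * j)"] 1 show ?thesis by linarith
  qed
  have "?B \<le> (\<Prod>j<m. 2 * exp (- y * real j))"
    using fac p1 by (intro prod_mono) (auto simp: \<tau>_def)
  also have "\<dots> = 2 ^ m * exp (- y * (\<Sum>j<m. real j))"
    by (simp add: prod.distrib exp_sum[symmetric] sum_distrib_left)
  also have "(\<Sum>j<m. real j) = real m * (real m - 1) / 2"
    by (induction m) (auto simp: field_simps)
  also have "2 ^ m * exp (- y * (real m * (real m - 1) / 2)) = (2 * exp (- (y * (real m - 1) / 2))) ^ m"
  proof -
    have "- y * (real m * (real m - 1) / 2) = real m * (- (y * (real m - 1) / 2))" by simp
    then show ?thesis by (simp only: power_mult_distrib exp_of_nat_mult)
  qed
  finally have B: "?B \<le> (2 * exp (- (y * (real m - 1) / 2))) ^ m" .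
  \<comment> \<open>Bernoulli's inequality and \<open>16 * k * \<delta> = \<epsilon>\<close> give
    \<open>\<gamma> ^ R \<ge> 1 - \<epsilon> / 4\<close>, which turns \<open>1 + \<epsilon>\<close>
    into \<open>1 + \<epsilon> / 2\<close>. The \<open>- 1\<close> pays for \<open>m - 1\<close> in
    place of \<open>m\<close>.\<close>
  have y2: "(1 + \<epsilon> / 2) * (real k * ln d) - 1 \<le> y * (real m - 1) / 2"
  proof -
    have "1 + real R * (- 4 * \<delta>) \<le> (1 + (- 4 * \<delta>)) ^ R"
      using \<delta>1 by (intro Bernoulli_inequality) auto
    moreover have "real R * (4 * \<delta>) \<le> real k * (4 * \<delta>)" using \<delta>0 by (intro mult_right_mono) (auto simp: R_def)
    ultimately have g: "1 - \<epsilon> / 4 \<le> \<gamma> ^ R" using \<delta>k by (simp add: \<gamma>_def)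
    have "1 + \<epsilon> / 2 \<le> (1 - \<epsilon> / 4) * (1 + \<epsilon>)"
    proof -
      have "\<epsilon> * \<epsilon> \<le> \<epsilon>" using \<epsilon> mult_left_le[of \<epsilon> \<epsilon>] by simp
      moreover have "(1 - \<epsilon> / 4) * (1 + \<epsilon>) = 1 + 3 / 4 * \<epsilon> - \<epsilon> * \<epsilon> / 4"
        by (simp add: field_simps)
      ultimately show ?thesis by linarith
    qed
    also have "\<dots> \<le> \<gamma> ^ R * (1 + \<epsilon>)" using g \<epsilon> by (intro mult_right_mono) auto
    finally have "(1 + \<epsilon> / 2) * (real k * ln d) \<le> \<gamma> ^ R * (1 + \<epsilon>) * (real k * ln d)"
      using lnd by (intro mult_right_mono) auto
    also have "\<dots> = 2 * \<gamma> ^ R / N * ((1 + \<epsilon>) * (real k * N * ln d / 2))"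
      using N0 by simp
    also have "\<dots> \<le> 2 * \<gamma> ^ R / N * real m"
      using m_lo \<gamma> N0 by (intro mult_left_mono) auto
    finally have 1: "(1 + \<epsilon> / 2) * (real k * ln d) \<le> 2 * \<gamma> ^ R / N * real m" .
    have "\<gamma> ^ R \<le> 1" using \<gamma> by (intro power_le_one) auto
    then have "2 * \<gamma> ^ R / N \<le> 1" using N128 by (simp add: field_simps)
    then have "2 * \<gamma> ^ R / N * real m - 1 \<le> 2 * \<gamma> ^ R / N * (real m - 1)"
      unfolding right_diff_distrib by simp
    with 1 show ?thesis by (simp add: y_def)
  qed
  \<comment> \<open>The expected number of edges is at most \<open>N * d ^ k / 2\<close>, and
    \<open>m \<ge> k * N * ln d / 2 \<ge> exp 1 * N / 2\<close>; so the base of the power is at most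
    \<open>d ^ k\<close>.\<close>
  have cnt: "real ((card V choose 2) choose m) * p ^ m \<le> exp (real k * ln d) ^ m"
  proof -
    have "real ((card V choose 2) choose m) * p ^ m \<le> (exp 1 * real (card V choose 2) / real m) ^ m * p ^ m"
      using m0 p0 by (intro mult_right_mono binomial_le_exp_pow) auto
    also have "\<dots> = (exp 1 * (real (card V choose 2) * p) / real m) ^ m"
      by (simp add: power_mult_distrib power_divide)
    also have "\<dots> \<le> (exp (real k * ln d)) ^ m"
    proof (intro power_mono)
      have "2 * (card V choose 2) \<le> card V * (card V - 1)"
        unfolding choose_two by simp
      also have "\<dots> \<le> card V * card V" by (intro mult_left_mono) auto
      finally have "2 * (card V choose 2) \<le> card V * card V" .
      then have "2 * real (card V choose 2) \<le> n * n"
        unfolding n_def by (metis of_nat_le_iff of_nat_mult of_nat_numeral)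
      then have "2 * real (card V choose 2) * p \<le> n * n * p" using p0 by (intro mult_right_mono)
      then have c: "real (card V choose 2) * p \<le> n * d / 2" by (simp add: dn)
      have "exp 1 * (real (card V choose 2) * p) \<le> exp 1 * (n * d / 2)"
        using c by (intro mult_left_mono) auto
      also have "\<dots> = exp 1 * N * d ^ k / 2"
        by (simp add: Nn[symmetric] kR)
      also have "\<dots> \<le> d ^ k * real m"
      proof -
        have "exp 1 \<le> (3::real)" by (rule exp_le)
        also have "3 \<le> real k * ln d" using k lnd mult_mono[of 2 "real k" 12 "ln d"] by simp
        finally have "exp 1 * N \<le> (real k * ln d) * N" using N0 by (intro mult_right_mono) auto
        then have "exp 1 * N / 2 \<le> real m" using m_lo x_ge by (simp add: algebra_simps)
        then have "d ^ k * (exp 1 * N / 2) \<le> d ^ k * real m" using d16 by (intro mult_left_mono) auto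
        then show ?thesis by (simp add: algebra_simps)
      qed
      finally show "exp 1 * (real (card V choose 2) * p) / real m \<le> exp (real k * ln d)"
        using m0 d16 by (simp add: exp_of_nat_mult field_simps)
    qed (use p0 in auto)
    finally show ?thesis .
  qed
  have "P (\<lambda>E. \<exists>M. k_matching k E M \<and> (1 + \<epsilon>) * (real k * N * ln d / 2) < real (card M)) \<le>
      P (\<lambda>E. \<exists>M. k_matching k E M \<and> m \<le> card M)"
  proof (intro P_mono)
    fix E assume "\<exists>M. k_matching k E M \<and> (1 + \<epsilon>) * (real k * N * ln d / 2) < real (card M)"
    then obtain M where "k_matching k E M" "(1 + \<epsilon>) * (real k * N * ln d / 2) < real (card M)" by blast
    moreover from this have "m \<le> card M" unfolding m_def by linarith
    ultimately show "\<exists>M. k_matching k E M \<and> m \<le> card M" by blast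
  qed
  also have "\<dots> \<le> real ((card V choose 2) choose m) * (p ^ m * ?B)"
    using k sep p1 by (intro P_k_matching prod_nonneg) (auto simp: \<tau>_def)
  also have "\<dots> = real ((card V choose 2) choose m) * p ^ m * ?B" by simp
  also have "\<dots> \<le> exp (real k * ln d) ^ m * (2 * exp (- (y * (real m - 1) / 2))) ^ m"
    using cnt B p1 by (intro mult_mono prod_nonneg) (auto simp: \<tau>_def)
  also have "\<dots> = (2 * exp (real k * ln d - y * (real m - 1) / 2)) ^ m"
  proof -
    have "exp x * (2 * exp (- z)) = 2 * exp (x - z)" for x z :: real
      by (simp add: exp_diff exp_minus divide_inverse)
    then show ?thesis by (simp only: power_mult_distrib[symmetric])
  qed
  \<comment> \<open>As \<open>k * \<epsilon> * ln d \<ge> 12\<close>, the exponent is at most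
    \<open>1 - 6 = - 5\<close>, which leaves room for the factor two.\<close>
  also have "\<dots> \<le> exp (- (1 / 2)) ^ m"
  proof (intro power_mono)
    have "6 \<le> \<epsilon> * ln d" using d4 \<epsilon> by (simp add: field_simps)
    moreover have "2 * (\<epsilon> * ln d) \<le> real k * (\<epsilon> * ln d)"
      using k \<open>6 \<le> _\<close> by (intro mult_right_mono) auto
    ultimately have "real k * ln d - y * (real m - 1) / 2 \<le> - 5"
      using y2 by (simp add: algebra_simps)
    then have "2 * exp (real k * ln d - y * (real m - 1) / 2) \<le> 2 * exp (- 5)" by simp
    also have "2 \<le> exp (1::real)" using exp_ge_add_one_self[of "1::real"] by simp
    then have "2 * exp (- 5::real) \<le> exp 1 * exp (- 5)" by (intro mult_right_mono) auto
    also have "\<dots> \<le> exp (- (1 / 2))" by (simp flip: exp_add)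
    finally show "2 * exp (real k * ln d - y * (real m - 1) / 2) \<le> exp (- (1 / 2))" by simp
  qed auto
  also have "\<dots> = exp (- real m / 2)" by (simp add: exp_of_nat_mult[symmetric])
  also have "\<dots> \<le> exp (- N / 2)" using mN by simp
  finally show ?thesis .
qed

end

subsection \<open>Small maximal matchings\<close>

text \<open>Exchanges hits and misses, so that the number of missed vertices can be treated by the
  lower tail.\<close>

lemma binomial_pmf_reflect:
  assumes q: "0 \<le> q" "q \<le> 1"
  shows "map_pmf (\<lambda>x. m - x) (binomial_pmf m q) = binomial_pmf m (1 - q)"
proof (rule pmf_eqI)
  fix y
  have q': "1 - q \<in> {0..1}" using q by auto
  have supp: "set_pmf (binomial_pmf m q) \<subseteq> {..m}"
    using q by (auto simp: set_pmf_binomial_eq split: if_splits)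
  show "pmf (map_pmf (\<lambda>x. m - x) (binomial_pmf m q)) y = pmf (binomial_pmf m (1 - q)) y"
  proof (cases "y \<le> m")
    case True
    have "pmf (map_pmf (\<lambda>x. m - x) (binomial_pmf m q)) y = measure_pmf.prob (binomial_pmf m q) {m - y}"
      unfolding pmf_map using supp True by (intro prob_cong_on_support) auto
    also have "\<dots> = pmf (binomial_pmf m (1 - q)) y"
      using q True binomial_symmetric[OF True] by (simp add: measure_pmf_single)
    finally show ?thesis .
  next
    case False
    have "measure_pmf.prob (binomial_pmf m q) ((\<lambda>x. m - x) -` {y}) = measure_pmf.prob (binomial_pmf m q) {}"
      using False by (intro prob_cong_on_support) auto
    then show ?thesis using False q by (simp add: pmf_map)
  qed
qed

context gnp
begin

text \<open>The number of missed vertices is binomial with mean at least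
  \<open>n * \<rho> / 2\<close>. The threshold \<open>u\<close>, about half of that, leaves at least
  \<open>(n * \<rho>)\<^sup>2 / 64\<close> unexposed pairs; \<open>8 \<le> n * \<rho>\<close>
  ensures \<open>u \<ge> 2\<close>, where \<open>u choose 2\<close> is at least
  \<open>u\<^sup>2 / 4\<close>.\<close>

lemma P_edge_free_unreached_one_le:
  fixes \<rho> :: real
  assumes AF: "A \<inter> F = {}" "A \<union> F \<subseteq> V" and \<rho>: "0 \<le> \<rho>" "\<rho> \<le> (1 - p) ^ card A"
    and n: "n / 2 \<le> real (card F)" "8 \<le> n * \<rho>"
  shows "P (\<lambda>E. edge_free E (unreached 1 A F E)) \<le> exp (- (n * \<rho> / 32)) + exp (- (p * (n * \<rho>)\<^sup>2 / 64))"
proof -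
  define u where "u = nat \<lceil>n * \<rho> / 4\<rceil>"
  have u: "n * \<rho> / 4 \<le> real u" unfolding u_def by (rule real_nat_ceiling_ge)
  have u2: "2 \<le> u" using u n(2) by linarith
  have "P (\<lambda>E. card F - card (nbr E A F) < u) =
      measure_pmf.prob (map_pmf (\<lambda>x. card F - x) (binomial_pmf (card F) (1 - (1 - p) ^ card A))) {y. y < u}"
    using P_card_nbr[OF AF, of "\<lambda>x. card F - x < u"] by (simp add: vimage_def)
  also have "\<dots> = measure_pmf.prob (binomial_pmf (card F) ((1 - p) ^ card A)) {y. y < u}"
    using nbr_prob_bounds[of "card A"] by (simp add: binomial_pmf_reflect)
  also have "\<dots> \<le> measure_pmf.prob (binomial_pmf (card F) ((1 - p) ^ card A)) {y. real y < (1 - 1 / 2) * (n * \<rho> / 2)}"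
    by (intro measure_pmf.finite_measure_mono) (auto simp: u_def zless_nat_eq_int_zless less_ceiling_iff)
  also have "\<dots> \<le> exp (- (1 / 2)\<^sup>2 * (n * \<rho> / 2) / 4)"
  proof (rule binomial_lower_tail)
    show "n * \<rho> / 2 \<le> real (card F) * (1 - p) ^ card A"
      using mult_mono[OF n(1) \<rho>(2)] \<rho>(1) by simp
  qed (use nbr_prob_bounds[of "card A"] n in auto)
  also have "\<dots> = exp (- (n * \<rho> / 32))" by (simp add: power2_eq_square)
  finally have 1: "P (\<lambda>E. card F - card (nbr E A F) < u) \<le> exp (- (n * \<rho> / 32))" .
  have "(n * \<rho>)\<^sup>2 / 64 \<le> real (u choose 2)"
  proof -
    have "(n * \<rho> / 4)\<^sup>2 \<le> (real u)\<^sup>2" using u n by (intro power_mono) auto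
    then have "(n * \<rho>)\<^sup>2 / 64 \<le> (real u)\<^sup>2 / 4" by (simp add: power_divide)
    also have "\<dots> \<le> real u * (real u - 1) / 2"
      using u2 by (simp add: power2_eq_square field_simps)
    also have "\<dots> = real (u choose 2)"
      using u2 by (simp add: choose_two real_of_nat_div of_nat_diff)
    finally show ?thesis .
  qed
  then have "p * ((n * \<rho>)\<^sup>2 / 64) \<le> p * real (u choose 2)" using p0 by (intro mult_left_mono)
  then have "exp (- (p * real (u choose 2))) \<le> exp (- (p * (n * \<rho>)\<^sup>2 / 64))" by simp
  with one_minus_power_le_exp[OF p1, of "u choose 2"]
  have 2: "(1 - p) ^ (u choose 2) \<le> exp (- (p * (n * \<rho>)\<^sup>2 / 64))" by linarith
  show ?thesis
    using P_edge_free_unreached_one[OF AF, of u] 1 2 by linarith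
qed

text \<open>By Bernoulli's inequality a vertex of \<open>F\<close> is reached with probability at
  most \<open>a * p\<close>.\<close>

lemma P_card_nbr_upper:
  fixes a \<delta> :: real
  assumes AF: "A \<inter> F = {}" "A \<union> F \<subseteq> V" and a: "real (card A) \<le> a" and \<delta>: "0 \<le> \<delta>" "\<delta> \<le> 1"
  shows "P (\<lambda>E. (1 + \<delta>) * (real (card V) * p * a) < real (card (nbr E A F)))
    \<le> exp (- \<delta>\<^sup>2 * (real (card V) * p * a) / 4)"
proof -
  have "1 - (1 - p) ^ card A \<le> real (card A) * p"
    using Bernoulli_inequality[of "- p" "card A"] p1 by simp
  also have "\<dots> \<le> a * p" using a p0 by (intro mult_right_mono)
  finally have "real (card F) * (1 - (1 - p) ^ card A) \<le> real (card V) * (a * p)"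
    using AF finV nbr_prob_bounds[of "card A"] by (intro mult_mono) (auto intro: card_mono)
  then show ?thesis
    unfolding P_card_nbr[OF AF, of "\<lambda>x. (1 + \<delta>) * (real (card V) * p * a) < real x"]
    using \<delta> nbr_prob_bounds by (intro binomial_upper_tail) (auto simp: algebra_simps)
qed

text \<open>A union bound over at most \<open>exp (k * ln d * s)\<close> vertex sets
  \<open>S\<close>. Levels growing too fast are handled by \<open>d3\<close>; too few missed
  vertices, and missed vertices without an edge, by \<open>d4\<close>. This gives
  \<open>R + 2 = k\<close> terms, each at most \<open>exp (- N)\<close> after the union
  bound.\<close>

lemma matching_lower_bound:
  fixes k :: nat and \<epsilon> \<delta> d N :: real
  assumes k: "k \<ge> 2" and \<epsilon>: "0 < \<epsilon>" "\<epsilon> \<le> 1 / 2" and \<delta>: "\<delta> = \<epsilon> / real k"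
    and d: "d = real (card V) * p" and N: "N = real (card V) / d ^ (k - 1)"
    and d1: "8 \<le> ln d" and d2: "2 * (real k)\<^sup>2 * ln d \<le> d"
    and d3: "real k * ln d + 1 \<le> \<delta>\<^sup>2 * d / 4"
    and d4: "(real k)\<^sup>2 * (ln d)\<^sup>2 + 1 \<le> exp (ln d / 2) / 32"
    and N1: "8 / \<delta> \<le> N"
  shows "P (\<lambda>E. \<exists>M. maximal_k_matching k E M \<and>
      real (card M) < (1 - \<epsilon>) * (real (k - 1) * N * ln d / 4)) \<le> real k * exp (- N)"
proof -
  define n where "n = real (card V)"
  define R where "R = k - 2"
  \<comment> \<open>Twice the claimed number of edges, since an edge covers two vertices.\<close>
  define x where "x = (1 - \<epsilon>) * (real (k - 1) * N * ln d / 2)"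
  define s where "s = nat \<lfloor>x\<rfloor>"
  define \<Lambda> where "\<Lambda> = (1 + \<delta>) * d"
  \<comment> \<open>This is \<open>d\<close> to the power \<open>- (k - 1) / 2\<close>, a lower
    bound for the chance of a vertex to be missed in the last round; it satisfies
    \<open>n * \<rho>\<^sup>2 = N\<close>.\<close>
  define \<rho> where "\<rho> = exp (- (real (k - 1) * ln d / 2))"
  have kR: "k = R + 2" "k - 1 = Suc R" using k by (auto simp: R_def)
  have \<delta>0: "0 < \<delta>" "\<delta> \<le> 1 / 4"
    using \<epsilon> k frac_le[of "1 / 2" \<epsilon> 2 "real k"] by (simp_all add: \<delta>)
  have dpos: "0 < d"
  proof -
    have "0 \<le> d" using p0 by (simp add: d)
    moreover have "d \<noteq> 0" using d1 by auto
    ultimately show ?thesis by simp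
  qed
  have d8: "8 \<le> d" using d1 ln_bound[OF dpos] by linarith
  have n0: "0 < n" using d d8 n_def by (cases "card V = 0") auto
  have dn: "d = n * p" by (simp add: d n_def)
  have N0: "0 < N" using n0 d8 by (simp add: N n_def)
  have N32: "32 \<le> N"
  proof -
    have "32 \<le> 8 / \<delta>" using \<delta>0 by (simp add: field_simps)
    then show ?thesis using N1 by linarith
  qed
  have Nn: "N * d ^ Suc R = n" using d8 by (simp add: N n_def kR)
  have pd: "p * d ^ R * N = 1"
  proof -
    have "p * d ^ R * N * n = d ^ R * N * d" by (simp add: dn)
    also have "\<dots> = n" using Nn by (simp add: algebra_simps)
    finally show ?thesis using n0 by simp
  qed
  have x2N: "2 * N \<le> x"
  proof -
    have "1 / 2 * (1 * N * 8 / 2) \<le> x"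
      unfolding x_def using \<epsilon> k N0 d1 by (intro mult_mono divide_right_mono) auto
    then show ?thesis by simp
  qed
  have s_le: "real s \<le> x" unfolding s_def using x2N N0 by (simp add: of_nat_floor)
  have s_ge: "N \<le> real s"
  proof -
    have "x - 1 \<le> real s" unfolding s_def using x2N N0 by linarith
    then show ?thesis using x2N N32 by linarith
  qed
  have s0: "0 < s" using s_ge N0 by linarith
  have xk: "x \<le> real k * N * ln d / 2"
  proof -
    have "x \<le> 1 * (real k * N * ln d / 2)"
      unfolding x_def using \<epsilon> k N0 d1 by (intro mult_mono divide_right_mono) auto
    then show ?thesis by simp
  qed
  have \<Lambda>1: "1 \<le> \<Lambda>" using mult_mono[of 1 "1 + \<delta>" 1 d] \<delta>0 d8 by (simp add: \<Lambda>_def)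
  \<comment> \<open>The growth errors of all levels together cost at most
    \<open>exp \<epsilon>\<close>, which the slack \<open>1 - \<epsilon>\<close> compensates because
    \<open>exp \<epsilon> * (1 - \<epsilon>) \<le> 1\<close>.\<close>
  have gr: "(1 + \<delta>) ^ j \<le> exp \<epsilon>" if "j \<le> k" for j
  proof -
    have "(1 + \<delta>) ^ j \<le> (1 + \<delta>) ^ k" using \<delta>0 that by (intro power_increasing) auto
    also have "\<dots> \<le> exp \<delta> ^ k" using \<delta>0 exp_ge_add_one_self[of \<delta>] by (intro power_mono) auto
    also have "\<dots> = exp \<epsilon>" using k by (simp add: exp_of_nat_mult[symmetric] \<delta>)
    finally show ?thesis .
  qed
  have small: "real k * (\<Lambda> ^ R * real s) \<le> n / 2"
  proof -
    have "exp \<epsilon> \<le> 2"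
    proof -
      have "exp \<epsilon> \<le> 1 + \<epsilon> + \<epsilon>\<^sup>2" using \<epsilon> by (intro exp_bound) auto
      moreover have "\<epsilon>\<^sup>2 \<le> (1 / 2)\<^sup>2" using \<epsilon> by (intro power_mono) auto
      ultimately show ?thesis using \<epsilon> by (simp add: power2_eq_square)
    qed
    then have "(1 + \<delta>) ^ R \<le> 2" using gr[of R] by (simp add: R_def)
    then have "\<Lambda> ^ R \<le> 2 * d ^ R" using d8 by (simp add: \<Lambda>_def power_mult_distrib)
    then have "\<Lambda> ^ R * real s \<le> (2 * d ^ R) * (real k * N * ln d / 2)"
      using s_le xk d8 by (intro mult_mono) auto
    then have "real k * (\<Lambda> ^ R * real s) \<le> real k * ((2 * d ^ R) * (real k * N * ln d / 2))"
      by (intro mult_left_mono) auto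
    also have "\<dots> = d ^ R * N / 2 * (2 * (real k)\<^sup>2 * ln d)" by (simp add: power2_eq_square)
    also have "\<dots> \<le> d ^ R * N / 2 * d" using d2 N0 d8 by (intro mult_left_mono) auto
    also have "\<dots> = n / 2" using Nn by (simp add: algebra_simps)
    finally show ?thesis .
  qed
  have s_card: "s \<le> card V"
  proof -
    have "1 * (1 * real s) \<le> real k * (\<Lambda> ^ R * real s)"
      using k \<Lambda>1 by (intro mult_mono) auto
    then have "real s \<le> real (card V)" using small n0 by (simp add: n_def)
    then show ?thesis by simp
  qed
  have \<rho>N: "n * \<rho>\<^sup>2 = N"
  proof -
    have "\<rho>\<^sup>2 = exp (- (real (k - 1) * ln d))" by (simp add: \<rho>_def exp_double[symmetric])
    also have "\<dots> = 1 / d ^ (k - 1)" using dpos by (simp add: exp_minus exp_of_nat_mult divide_inverse)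
    finally show ?thesis by (simp add: N n_def)
  qed
  have n\<rho>: "N * exp (ln d / 2) \<le> n * \<rho>"
  proof -
    have "exp (ln d / 2) * \<rho> \<le> 1"
    proof -
      have "1 * ln d \<le> real (k - 1) * ln d" using k d1 by (intro mult_right_mono) auto
      then show ?thesis by (simp add: \<rho>_def exp_add[symmetric])
    qed
    then have "n * \<rho> * (exp (ln d / 2) * \<rho>) \<le> n * \<rho> * 1"
      using n0 by (intro mult_left_mono) (auto simp: \<rho>_def)
    moreover have "n * \<rho> * (exp (ln d / 2) * \<rho>) = n * \<rho>\<^sup>2 * exp (ln d / 2)"
      by (simp add: power2_eq_square)
    ultimately show ?thesis unfolding \<rho>N by simp
  qed
  have \<rho>_le: "\<rho> \<le> (1 - p) ^ j" if j: "real j \<le> \<Lambda> ^ R * real s" for j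
  proof -
    have p: "4 * p \<le> \<delta>"
    proof -
      have "1 \<le> d ^ R" using d8 by (intro one_le_power) auto
      then have "p * N * 1 \<le> p * N * d ^ R" using p0 N0 by (intro mult_left_mono) auto
      then have "p * N \<le> 1" using pd by (simp add: algebra_simps)
      then have "p \<le> 1 / N" using N0 by (simp add: field_simps)
      also have "\<dots> \<le> \<delta> / 8" using N1 \<delta>0 N0 by (simp add: field_simps)
      finally show ?thesis using \<delta>0 by simp
    qed
    \<comment> \<open>Passing from \<open>1 - p\<close> to an exponential needs the larger rate
      \<open>(1 + \<delta>) * p\<close>; the quadratic error is at most
      \<open>4 * p * p \<le> \<delta> * p\<close>.\<close>
    have e: "exp (- ((1 + \<delta>) * p)) \<le> 1 - p"
    proof -
      have "exp (- ((1 + \<delta>) * p)) \<le> 1 - (1 + \<delta>) * p + ((1 + \<delta>) * p)\<^sup>2"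
        using \<delta>0 p0 by (intro exp_minus_le_quadratic) auto
      also have "((1 + \<delta>) * p)\<^sup>2 \<le> (2 * p)\<^sup>2"
        using \<delta>0 p0 by (intro power_mono mult_right_mono) auto
      also have "(2 * p)\<^sup>2 = p * (4 * p)" by (simp add: power2_eq_square)
      also have "\<dots> \<le> p * \<delta>" using p p0 by (intro mult_left_mono)
      finally show ?thesis by (simp add: algebra_simps)
    qed
    have "real j * ((1 + \<delta>) * p) \<le> \<Lambda> ^ R * real s * ((1 + \<delta>) * p)"
      using j \<delta>0 p0 by (intro mult_right_mono) auto
    also have "\<dots> = (1 + \<delta>) ^ Suc R * (p * d ^ R * N) * real s / N"
      using N0 by (simp add: \<Lambda>_def power_mult_distrib)
    also have "\<dots> = (1 + \<delta>) ^ Suc R * real s / N" by (simp add: pd)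
    also have "\<dots> \<le> exp \<epsilon> * x / N"
      using gr[of "Suc R"] s_le N0 by (intro divide_right_mono mult_mono) (auto simp: kR)
    also have "\<dots> = exp \<epsilon> * (1 - \<epsilon>) * (real (k - 1) * ln d / 2)" using N0 by (simp add: x_def)
    also have "\<dots> \<le> 1 * (real (k - 1) * ln d / 2)"
    proof (intro mult_right_mono)
      have "exp \<epsilon> * (1 - \<epsilon>) \<le> exp \<epsilon> * exp (- \<epsilon>)"
        using exp_ge_add_one_self[of "- \<epsilon>"] by (intro mult_left_mono) auto
      then show "exp \<epsilon> * (1 - \<epsilon>) \<le> 1" by (simp add: exp_minus)
    qed (use d1 in auto)
    finally have "\<rho> \<le> exp (real j * (- ((1 + \<delta>) * p)))" by (simp add: \<rho>_def)
    also have "\<dots> = exp (- ((1 + \<delta>) * p)) ^ j" by (rule exp_of_nat_mult)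
    also have "\<dots> \<le> (1 - p) ^ j" using e by (intro power_mono) auto
    finally show ?thesis .
  qed
  \<comment> \<open>The first level has the weakest concentration, so its deviation bound serves for
    every level.\<close>
  define \<tau> where "\<tau> = exp (- \<delta>\<^sup>2 * d * real s / 4)"
  define \<sigma> where "\<sigma> = exp (- (n * \<rho> / 32)) + exp (- (p * (n * \<rho>)\<^sup>2 / 64))"
  have one: "P (\<lambda>E. edge_free E (unreached (k - 1) S (V - S) E)) \<le> real R * \<tau> + \<sigma>"
    if S: "S \<subseteq> V" "card S = s" for S
    unfolding kR(2)
  proof (rule P_edge_free_unreached[where a = "\<lambda>i. \<Lambda> ^ i * real s" and fmin = "n - real s"])
    have finS: "finite S" using S finV finite_subset by auto
    show "n - real s \<le> real (card (V - S))"
      using S finS finV card_mono[OF finV S(1)] by (simp add: card_Diff_subset n_def of_nat_diff)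
    show "P (\<lambda>E. edge_free E (unreached 1 A F E)) \<le> \<sigma>"
      if AF: "A \<inter> F = {}" "A \<union> F \<subseteq> V" "real (card A) \<le> \<Lambda> ^ R * real s"
        "n - real s - (\<Sum>i<R. \<Lambda> ^ Suc i * real s) \<le> real (card F)" for A F
      unfolding \<sigma>_def
    proof (rule P_edge_free_unreached_one_le)
      have "(\<Sum>i<R. \<Lambda> ^ Suc i * real s) \<le> (\<Sum>i<R. \<Lambda> ^ R * real s)"
        using \<Lambda>1 by (intro sum_mono mult_right_mono power_increasing) auto
      moreover have "1 * real s \<le> \<Lambda> ^ R * real s"
        using \<Lambda>1 by (intro mult_right_mono one_le_power) auto
      moreover have "0 \<le> \<Lambda> ^ R * real s" using \<Lambda>1 by simp
      ultimately have "real s + (\<Sum>i<R. \<Lambda> ^ Suc i * real s) \<le> real k * (\<Lambda> ^ R * real s)"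
        by (simp add: kR(1) algebra_simps)
      then show "n / 2 \<le> real (card F)" using AF(4) small by linarith
      show "\<rho> \<le> (1 - p) ^ card A" using AF(3) by (rule \<rho>_le)
      have "1 \<le> exp (ln d / 2)" using d1 by simp
      then have "N * 1 \<le> N * exp (ln d / 2)" using N0 by (intro mult_left_mono) auto
      then show "8 \<le> n * \<rho>" using n\<rho> N32 by linarith
    qed (use AF in \<open>auto simp: \<rho>_def\<close>)
    show "P (\<lambda>E. \<Lambda> ^ Suc i * real s < real (card (nbr E A F))) \<le> \<tau>"
      if i: "i < R" "A \<inter> F = {}" "A \<union> F \<subseteq> V" "real (card A) \<le> \<Lambda> ^ i * real s" for i A F
    proof -
      have eq: "\<Lambda> ^ Suc i * real s = (1 + \<delta>) * (real (card V) * p * (\<Lambda> ^ i * real s))"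
        by (simp add: \<Lambda>_def d)
      have "P (\<lambda>E. \<Lambda> ^ Suc i * real s < real (card (nbr E A F))) \<le>
          exp (- \<delta>\<^sup>2 * (real (card V) * p * (\<Lambda> ^ i * real s)) / 4)"
        unfolding eq using i \<delta>0 by (intro P_card_nbr_upper) auto
      also have "\<dots> \<le> \<tau>"
      proof -
        have "1 * real s \<le> \<Lambda> ^ i * real s" using \<Lambda>1 by (intro mult_right_mono one_le_power) auto
        then have "\<delta>\<^sup>2 * d * (1 * real s) \<le> \<delta>\<^sup>2 * d * (\<Lambda> ^ i * real s)"
          using d8 by (intro mult_left_mono) auto
        then show ?thesis unfolding \<tau>_def d[symmetric] by (simp add: mult.assoc)
      qed
      finally show ?thesis .
    qed
  qed (use S in \<open>auto simp: \<tau>_def \<sigma>_def\<close>)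
  have "P (\<lambda>E. \<exists>M. maximal_k_matching k E M \<and> real (card M) < (1 - \<epsilon>) * (real (k - 1) * N * ln d / 4)) \<le>
      P (\<lambda>E. \<exists>S\<in>{S. S \<subseteq> V \<and> card S = s}. edge_free E (unreached (k - 1) S (V - S) E))"
  proof (rule P_mono)
    fix E assume E: "E \<subseteq> [V]\<^bsup>2\<^esup>"
      and "\<exists>M. maximal_k_matching k E M \<and> real (card M) < (1 - \<epsilon>) * (real (k - 1) * N * ln d / 4)"
    then obtain M where M: "maximal_k_matching k E M" "real (card M) < (1 - \<epsilon>) * (real (k - 1) * N * ln d / 4)"
      by blast
    have ME: "M \<subseteq> [V]\<^bsup>2\<^esup>" using M E by (auto simp: maximal_k_matching_def k_matching_def)
    have "card (\<Union>M) \<le> (\<Sum>e\<in>M. card e)" by (rule card_Union_le_sum_card)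
    also have "\<dots> = (\<Sum>e\<in>M. 2)" using ME by (intro sum.cong) (auto simp: nsets_def)
    finally have "real (card (\<Union>M)) \<le> 2 * real (card M)" by simp
    moreover have "x = 2 * ((1 - \<epsilon>) * (real (k - 1) * N * ln d / 4))" by (simp add: x_def)
    ultimately have "real (card (\<Union>M)) \<le> x" using M(2) by linarith
    then have "card (\<Union>M) \<le> s" unfolding s_def by linarith
    moreover have "\<Union>M \<subseteq> V" using ME by (auto simp: nsets_def)
    \<comment> \<open>Pad the covered vertices to exactly \<open>s\<close> of them, as the union
      bound ranges over sets of that size.\<close>
    ultimately obtain S where S: "\<Union>M \<subseteq> S" "S \<subseteq> V" "card S = s"
      using exists_subset_between[of "\<Union>M" s V] s_card finV by auto
    then show "\<exists>S\<in>{S. S \<subseteq> V \<and> card S = s}. edge_free E (unreached (k - 1) S (V - S) E)"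
      using maximal_edge_free_unreached[OF E S(2,1) _ M(1)] k by auto
  qed
  also have "\<dots> \<le> real (card {S. S \<subseteq> V \<and> card S = s}) * (real R * \<tau> + \<sigma>)"
    using finV one by (intro P_union_bound) auto
  also have "card {S. S \<subseteq> V \<and> card S = s} = card V choose s"
    using finV by (simp add: n_subsets)
  finally have union: "P (\<lambda>E. \<exists>M. maximal_k_matching k E M \<and>
      real (card M) < (1 - \<epsilon>) * (real (k - 1) * N * ln d / 4)) \<le>
      real (card V choose s) * (real R * \<tau> + \<sigma>)" .
  \<comment> \<open>Since \<open>s \<ge> N\<close> and \<open>exp 1 \<le> d\<close>, the base
    \<open>exp 1 * n / s\<close> is at most \<open>exp 1 * d ^ (k - 1) \<le> d ^ k\<close>.\<close>
  have "real (card V choose s) \<le> exp (real k * ln d * real s)"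
  proof -
    have "real (card V choose s) \<le> (exp 1 * n / real s) ^ s"
      unfolding n_def using s0 by (rule binomial_le_exp_pow)
    also have "\<dots> \<le> exp (real k * ln d) ^ s"
    proof (intro power_mono)
      have "exp 1 * n / real s \<le> exp 1 * n / N"
        using s_ge N0 n0 by (intro divide_left_mono) auto
      also have "\<dots> = exp 1 * d ^ Suc R" using Nn N0 by (simp add: field_simps)
      also have "\<dots> \<le> d * d ^ Suc R"
        using exp_le d8 by (intro mult_right_mono) auto
      also have "\<dots> = d ^ k" by (simp add: kR(1))
      also have "\<dots> = exp (real k * ln d)" using dpos by (simp add: exp_of_nat_mult)
      finally show "exp 1 * n / real s \<le> exp (real k * ln d)" .
    qed (use n0 in auto)
    finally show ?thesis by (simp add: exp_of_nat_mult[symmetric] mult.commute)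
  qed
  note union
  also have "real (card V choose s) * (real R * \<tau> + \<sigma>) \<le> exp (real k * ln d * real s) * (real R * \<tau> + \<sigma>)"
    using \<open>real (card V choose s) \<le> _\<close>
    by (intro mult_right_mono) (auto simp: \<tau>_def \<sigma>_def)
  also have "\<dots> \<le> real k * exp (- N)"
  proof -
    have e1: "exp (real k * ln d * real s) * \<tau> \<le> exp (- N)"
    proof -
      have "(real k * ln d + 1) * real s \<le> \<delta>\<^sup>2 * d / 4 * real s" using d3 by (intro mult_right_mono) auto
      then show ?thesis using s_ge by (simp add: \<tau>_def exp_add[symmetric] algebra_simps)
    qed
    have ks: "real k * ln d * real s \<le> N * ((real k)\<^sup>2 * (ln d)\<^sup>2)"
    proof -
      have "real k * ln d * real s \<le> real k * ln d * (real k * N * ln d)"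
        using s_le xk d1 N0 by (intro mult_left_mono) (auto intro: order_trans)
      then show ?thesis by (simp add: power2_eq_square algebra_simps)
    qed
    have e2: "exp (real k * ln d * real s) * exp (- (n * \<rho> / 32)) \<le> exp (- N)"
    proof -
      have "N * ((real k)\<^sup>2 * (ln d)\<^sup>2 + 1) \<le> N * (exp (ln d / 2) / 32)"
        using d4 N0 by (intro mult_left_mono) auto
      then have "real k * ln d * real s + N \<le> n * \<rho> / 32" using ks n\<rho> by (simp add: algebra_simps)
      then show ?thesis by (simp add: exp_add[symmetric])
    qed
    have e3: "exp (real k * ln d * real s) * exp (- (p * (n * \<rho>)\<^sup>2 / 64)) \<le> exp (- N)"
    proof -
      have "p * (n * \<rho>)\<^sup>2 = (n * p) * (n * \<rho>\<^sup>2)" by (simp add: power2_eq_square)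
      also have "\<dots> = d * N" by (simp add: \<rho>N dn)
      finally have *: "p * (n * \<rho>)\<^sup>2 = d * N" .
      \<comment> \<open>From \<open>2 * exp (ln d / 2) \<le> d\<close>, hypothesis \<open>d4\<close>
        also yields the bound with \<open>d / 64\<close>.\<close>
      have "2 * exp (ln d / 2) \<le> exp (ln d / 2) * exp (ln d / 2)"
      proof (intro mult_right_mono)
        show "2 \<le> exp (ln d / 2)" using d1 exp_ge_add_one_self[of "ln d / 2"] by linarith
      qed auto
      also have "\<dots> = d" using dpos by (simp add: exp_add[symmetric])
      finally have "(real k)\<^sup>2 * (ln d)\<^sup>2 + 1 \<le> d / 64" using d4 by linarith
      then have "N * ((real k)\<^sup>2 * (ln d)\<^sup>2 + 1) \<le> N * (d / 64)"
        using N0 by (intro mult_left_mono) auto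
      then have "real k * ln d * real s + N \<le> d * N / 64" using ks by (simp add: algebra_simps)
      then show ?thesis unfolding * by (simp add: exp_add[symmetric])
    qed
    have "exp (real k * ln d * real s) * (real R * \<tau> + \<sigma>) =
        real R * (exp (real k * ln d * real s) * \<tau>) +
        (exp (real k * ln d * real s) * exp (- (n * \<rho> / 32)) +
         exp (real k * ln d * real s) * exp (- (p * (n * \<rho>)\<^sup>2 / 64)))"
      by (simp add: \<sigma>_def distrib_left)
    also have "\<dots> \<le> real R * exp (- N) + (exp (- N) + exp (- N))"
      by (intro add_mono mult_left_mono e1 e2 e3) auto
    also have "\<dots> = real k * exp (- N)" by (simp add: kR(1) algebra_simps)
    finally show ?thesis .
  qed
  finally show ?thesis .
qed

end

section \<open>Choice of the constant and passage to the limit\<close>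

lemma eventually_large_degree:
  fixes K \<epsilon> \<delta> \<delta>' :: real
  assumes "0 < K" "0 < \<epsilon>" "0 < \<delta>" "0 < \<delta>'"
  shows "\<forall>\<^sub>F d in at_top. 1 \<le> d \<and> 1 \<le> 4 * \<delta> * d \<and> 2 * K\<^sup>2 * ln d \<le> \<delta> * d \<and>
    K * exp (- \<delta>\<^sup>2 * d / 4) \<le> exp (- 4 * K * ln d) \<and> 6 / \<epsilon> \<le> ln d \<and>
    8 \<le> ln d \<and> 2 * K\<^sup>2 * ln d \<le> d \<and> K * ln d + 1 \<le> \<delta>'\<^sup>2 * d / 4 \<and>
    K\<^sup>2 * (ln d)\<^sup>2 + 1 \<le> exp (ln d / 2) / 32"
  using assms by (intro eventually_conj; real_asymp)

theorem theorem1p1: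
  fixes k :: nat and \<epsilon> :: real
  assumes "k \<ge> 2" and "\<epsilon> > 0"
  shows "\<exists>c::real. \<forall>(p :: nat \<Rightarrow> real) (d :: nat \<Rightarrow> real).
    (\<forall>n. 0 \<le> p n \<and> p n \<le> 1) \<longrightarrow>
    (\<forall>n. d n = real n * p n) \<longrightarrow>
    (\<forall>\<^sub>F n in sequentially. d n \<ge> c) \<longrightarrow>
    (\<lambda>n. d n ^ (k - 1)) \<in> o(\<lambda>n. real n) \<longrightarrow>
    (\<lambda>n. measure_pmf.prob (random_graph n (p n))
       {G. \<forall>M. maximal_k_matching k G M \<longrightarrow>
             (1 - \<epsilon>) * (real (k - 1) * real n * ln (d n) / (4 * d n ^ (k - 1))) \<le> real (card M) \<and>
             real (card M) \<le> (1 + \<epsilon>) * (real k * real n * ln (d n) / (2 * d n ^ (k - 1)))})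
      \<longlonglongrightarrow> 1"
proof -
  \<comment> \<open>Both estimates need a tolerance of at most one half, and a smaller tolerance
    gives a stronger conclusion.\<close>
  define \<eta> where "\<eta> = min \<epsilon> (1 / 2)"
  define \<delta> where "\<delta> = \<eta> / (16 * real k)"
  define \<delta>' where "\<delta>' = \<eta> / real k"
  have \<eta>: "0 < \<eta>" "\<eta> \<le> 1 / 2" "\<eta> \<le> \<epsilon>" using assms by (auto simp: \<eta>_def)
  have pos: "0 < real k" "0 < \<delta>" "0 < \<delta>'" using assms \<eta> by (auto simp: \<delta>_def \<delta>'_def)
  \<comment> \<open>The constant depends only on \<open>k\<close> and \<open>\<epsilon>\<close>; it
    collects every lower bound on the degree required by the two estimates.\<close>
  obtain c where c: "\<And>d. c \<le> d \<Longrightarrow> 1 \<le> d \<and> 1 \<le> 4 * \<delta> * d \<and> 2 * (real k)\<^sup>2 * ln d \<le> \<delta> * d \<and>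
      real k * exp (- \<delta>\<^sup>2 * d / 4) \<le> exp (- 4 * real k * ln d) \<and> 6 / \<eta> \<le> ln d \<and>
      8 \<le> ln d \<and> 2 * (real k)\<^sup>2 * ln d \<le> d \<and> real k * ln d + 1 \<le> \<delta>'\<^sup>2 * d / 4 \<and>
      (real k)\<^sup>2 * (ln d)\<^sup>2 + 1 \<le> exp (ln d / 2) / 32"
    using eventually_large_degree[OF pos(1) \<eta>(1) pos(2,3)] unfolding eventually_at_top_linorder by blast
  show ?thesis
  proof (intro exI[of _ c] allI impI)
    fix p d :: "nat \<Rightarrow> real"
    assume p: "\<forall>n. 0 \<le> p n \<and> p n \<le> 1" and d: "\<forall>n. d n = real n * p n"
      and dc: "\<forall>\<^sub>F n in sequentially. d n \<ge> c" and o: "(\<lambda>n. d n ^ (k - 1)) \<in> o(\<lambda>n. real n)"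
    define N where "N n = real n / d n ^ (k - 1)" for n
    define good where "good n = {G :: nat set set. \<forall>M. maximal_k_matching k G M \<longrightarrow>
        (1 - \<epsilon>) * (real (k - 1) * real n * ln (d n) / (4 * d n ^ (k - 1))) \<le> real (card M) \<and>
        real (card M) \<le> (1 + \<epsilon>) * (real k * real n * ln (d n) / (2 * d n ^ (k - 1)))}" for n
    \<comment> \<open>For positive degrees, \<open>d ^ (k - 1) = o(n)\<close> says that
      \<open>N\<close> tends to infinity; the little-o constant \<open>1 / Z\<close> gives
      \<open>N \<ge> Z\<close>.\<close>
    have N_top: "filterlim N at_top sequentially"
      unfolding filterlim_at_top_gt[where c = 0]
    proof (intro allI impI)
      fix Z :: real assume Z: "0 < Z"
      then have "\<forall>\<^sub>F n in sequentially. norm (d n ^ (k - 1)) \<le> 1 / Z * norm (real n)"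
        by (intro landau_o.smallD[OF o]) simp
      then show "\<forall>\<^sub>F n in sequentially. Z \<le> N n"
        using dc
      proof eventually_elim
        case (elim n)
        have "0 < d n ^ (k - 1)" using c[OF elim(2)] by simp
        then show ?case using elim(1) Z by (simp add: N_def field_simps)
      qed
    qed
    have lower: "\<forall>\<^sub>F n in sequentially. 1 - (exp (- N n / 2) + real k * exp (- N n)) \<le>
        measure_pmf.prob (random_graph n (p n)) (good n)"
      using dc filterlim_at_top[THEN iffD1, OF N_top, rule_format, of "2 / \<delta>"]
        filterlim_at_top[THEN iffD1, OF N_top, rule_format, of "8 / \<delta>'"]
    proof eventually_elim
      case (elim n)
      interpret gnp "{1..n}" "p n"
        using p by unfold_locales auto
      have dn: "d n = real (card {1..n}) * p n" and Nn: "N n = real (card {1..n}) / d n ^ (k - 1)"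
        using d by (simp_all add: N_def)
      have nonneg: "0 \<le> N n * ln (d n)" using c[OF elim(1)] by (simp add: N_def)
      have eqs: "real (k - 1) * real n * ln (d n) / (4 * d n ^ (k - 1)) = real (k - 1) * N n * ln (d n) / 4"
          "real k * real n * ln (d n) / (2 * d n ^ (k - 1)) = real k * N n * ln (d n) / 2"
        by (simp_all add: N_def)
      \<comment> \<open>The two failures are treated separately: the upper bound concerns every
        \<open>k\<close>-matching, the lower bound only maximal ones.\<close>
      define bad1 where "bad1 E \<longleftrightarrow> (\<exists>M. k_matching k E M \<and>
          (1 + \<eta>) * (real k * N n * ln (d n) / 2) < real (card M))" for E :: "nat set set"
      define bad2 where "bad2 E \<longleftrightarrow> (\<exists>M. maximal_k_matching k E M \<and>
          real (card M) < (1 - \<eta>) * (real (k - 1) * N n * ln (d n) / 4))" for E :: "nat set set"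
      have "E \<in> good n" if "\<not> (bad1 E \<or> bad2 E)" for E
        unfolding good_def mem_Collect_eq eqs
      proof (intro allI impI conjI)
        fix M assume M: "maximal_k_matching k E M"
        have "(1 - \<epsilon>) * (real (k - 1) * N n * ln (d n) / 4) \<le> (1 - \<eta>) * (real (k - 1) * N n * ln (d n) / 4)"
          using \<eta>(3) nonneg by (intro mult_right_mono) (auto simp: mult.assoc)
        also have "\<dots> \<le> real (card M)" using that M by (auto simp: bad2_def not_less)
        finally show "(1 - \<epsilon>) * (real (k - 1) * N n * ln (d n) / 4) \<le> real (card M)" .
        have "real (card M) \<le> (1 + \<eta>) * (real k * N n * ln (d n) / 2)"
          using that M by (auto simp: bad1_def not_less maximal_k_matching_def)
        also have "\<dots> \<le> (1 + \<epsilon>) * (real k * N n * ln (d n) / 2)"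
          using \<eta>(3) nonneg by (intro mult_right_mono) (auto simp: mult.assoc)
        finally show "real (card M) \<le> (1 + \<epsilon>) * (real k * N n * ln (d n) / 2)" .
      qed
      then have "measure_pmf.prob (random_graph n (p n)) (- good n) \<le> P (\<lambda>E. bad1 E \<or> bad2 E)"
        unfolding P_def random_graph_def random_subset_def by (intro measure_pmf.finite_measure_mono) auto
      also have "\<dots> \<le> P bad1 + P bad2" by (rule P_disj)
      also have "P bad1 \<le> exp (- N n / 2)"
        unfolding bad1_def[abs_def]
        by (rule matching_upper_bound[OF assms(1) \<eta>(1,2) \<delta>_def dn Nn]) (use c[OF elim(1)] elim in auto)
      also have "P bad2 \<le> real k * exp (- N n)"
        unfolding bad2_def[abs_def]
        by (rule matching_lower_bound[OF assms(1) \<eta>(1,2) \<delta>'_def dn Nn]) (use c[OF elim(1)] elim in auto)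
      finally show ?case
        using measure_pmf.prob_compl[of "good n" "random_graph n (p n)"] by (simp add: Compl_eq_Diff_UNIV)
    qed
    have lim: "(\<lambda>n. 1 - (exp (- N n / 2) + real k * exp (- N n))) \<longlonglongrightarrow> 1"
    proof -
      have "((\<lambda>x::real. 1 - (exp (- x / 2) + real k * exp (- x))) \<longlongrightarrow> 1) at_top" by real_asymp
      from filterlim_compose[OF this N_top] show ?thesis .
    qed
    have "(\<lambda>n. measure_pmf.prob (random_graph n (p n)) (good n)) \<longlonglongrightarrow> 1"
      by (rule tendsto_sandwich[OF lower _ lim tendsto_const]) simp
    then show "(\<lambda>n. measure_pmf.prob (random_graph n (p n))
       {G. \<forall>M. maximal_k_matching k G M \<longrightarrow>
             (1 - \<epsilon>) * (real (k - 1) * real n * ln (d n) / (4 * d n ^ (k - 1))) \<le> real (card M) \<and>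
             real (card M) \<le> (1 + \<epsilon>) * (real k * real n * ln (d n) / (2 * d n ^ (k - 1)))})
      \<longlonglongrightarrow> 1"
      unfolding good_def .
  qed
qed

end
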